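(* (Generalised Littlewood-Richardson rule, integral formulation.) For all $\kappa,\lambda,\mu,\nu\in\mathcal P$: $$ \langle s_{\lambda/\kappa},s_{\nu/\mu}\rangle=\sum_{M\in\mathcal M_{\lambda-\kappa,\;\nu-\mu}}\Bigl[\forall l\in\mathbf N:\ \kappa+\sum_{j<l}M^t_j\leftharpoondown\kappa+\sum_{j\le l}M^t_j\Bigr]\,\Bigl[\forall k\in\mathbf N:\ \mu+\sum_{i<k}M_i\leftharpoondown\mu+\sum_{i\le k}M_i\Bigr] $$ $$ \qquad=\sum_{M\in\mathcal M}\bigl[M\in\operatorname{Tabl}(\lambda/\kappa)\bigr]\,\bigl[M^t\in\operatorname{Tabl}(\nu/\mu)\bigr], $$ where $M^t$ denotes the transpose of $M$.
   Context: $\mathbf N=\{0,1,2,\ldots\}$. A composition is a finitely supported sequence $\alpha=(\alpha_i)_{i\in\mathbf N}$ of natural numbers; $\mathcal C$ is the set of all compositions, added entrywise, and $|\alpha|=\sum_i\alpha_i$. $\mathcal P\subset\mathcal C$ is the set of partitions, i.e. weakly decreasing compositions. Finite vectors are extended by zeros, so $\mathbf N^n\subset\mathcal C$. The Iverson bracket $[\text{condition}]$ is $1$ if the condition holds and $0$ otherwise. For compositions $\alpha,\beta$, the relation $\alpha\leftharpoondown\beta$ means that $\alpha,\beta\in\mathcal P$ and $\beta_{i+1}\le\alpha_i\le\beta_i$ for all $i\in\mathbf N$. Matrices: $\mathcal M$ is the set of matrices $M=(M_{i,j})_{i,j\in\mathbf N}$ with entries in $\mathbf N$, only finitely many nonzero.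 $M_i=(M_{i,j})_{j\in\mathbf N}$ is row $i$ and $M^t_j=(M_{i,j})_{i\in\mathbf N}$ is column $j$ of $M$, considered as compositions. $\operatorname{row}(M)=(\sum_jM_{i,j})_i$, $\operatorname{col}(M)=(\sum_iM_{i,j})_j$, and $\mathcal M_{\alpha,\beta}=\{M\in\mathcal M:\operatorname{row}(M)=\alpha,\ \operatorname{col}(M)=\beta\}$ (which is empty if $\alpha$ or $\beta$ has a negative entry). Tableaux: a semistandard tableau of shape $\lambda/\mu$ is a sequence of partitions $(\lambda^{(i)})_{i\in\mathbf N}$ with $\lambda^{(0)}=\mu$, $\lambda^{(i)}\leftharpoondown\lambda^{(i+1)}$ for all $i$, and $\lambda^{(N)}=\lambda$ for all sufficiently large $N$ (none exists unless $\mu_i\le\lambda_i$ for all $i$). Its integral encoding is the matrix $M\in\mathcal M$ with $M_{i,j}=(\lambda^{(j+1)}-\lambda^{(j)})_i$. $\operatorname{Tabl}(\lambda/\mu)\subset\mathcal M$ is the set of integral encodings of all semistandard tableaux of shape $\lambda/\mu$. $\Lambda$ is the ring of symmetric functions over $\mathbf Z$ (symmetric power series of bounded degree in indeterminates $X_i$, $i\in\mathbf N$). Schur functions: for $\alpha\in\mathbf N^n$ put $a_\alpha[X_{[n]}]=\sum_{\sigma\in\mathbf S_n}\operatorname{sgn}(\sigma)\prod_{i=0}^{n-1}X_{\sigma(i)}^{\alpha_i}$, let $\delta_n=(n-1,\ldots,1,0)$, and set $s_\alpha[X_{[n]}]=a_{\delta_n+\alpha}[X_{[n]}]/a_{\delta_n}[X_{[n]}]$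 for $\alpha\in\mathbf N^n$ and $s_\alpha[X_{[n]}]=0$ for $\alpha\in\mathcal C\setminus\mathbf N^n$. Then $s_\alpha\in\Lambda$ is the unique symmetric function which for every $n$ becomes $s_\alpha[X_{[n]}]$ upon setting $X_i=0$ for all $i\ge n$. The set $\{s_\lambda:\lambda\in\mathcal P\}$ is a $\mathbf Z$-basis of $\Lambda$; $\langle\cdot,\cdot\rangle$ is the scalar product on $\Lambda$ for which this basis is orthonormal. For $\lambda,\mu\in\mathcal P$ the skew Schur function $s_{\lambda/\mu}$ is characterised by $\langle s_{\lambda/\mu},f\rangle=\langle s_\lambda,s_\mu f\rangle$ for all $f\in\Lambda$ (so $s_{\lambda/\mu}=0$ unless $\mu_i\le\lambda_i$ for all $i$). *)

theory Defs
  imports "HOL.Modules" "HOL-Library.Poly_Mapping" "HOL-Combinatorics.Permutations"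
begin

section \<open>Compositions and partitions\<close>

type_synonym composition = "nat \<Rightarrow>\<^sub>0 nat"

definition csize :: "composition \<Rightarrow> nat" where
  "csize \<alpha> = (\<Sum>i\<in>Poly_Mapping.keys \<alpha>. Poly_Mapping.lookup \<alpha> i)"

definition partitions :: "composition set" where
  "partitions = {\<alpha>. \<forall>i. Poly_Mapping.lookup \<alpha> (Suc i) \<le> Poly_Mapping.lookup \<alpha> i}"

text \<open>The subset \<open>\<nat>\<^sup>n\<close> of the set of compositions.\<close>

definition compositions_upto :: "nat \<Rightarrow> composition set" where
  "compositions_upto n = {\<alpha>. \<forall>i\<ge>n. Poly_Mapping.lookup \<alpha> i = 0}"

definition interlaces :: "composition \<Rightarrow> composition \<Rightarrow> bool"  (infix \<open>\<leftharpoondown>\<close> 50) where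
  "\<alpha> \<leftharpoondown> \<beta> \<longleftrightarrow> \<alpha> \<in> partitions \<and> \<beta> \<in> partitions \<and>
     (\<forall>i. Poly_Mapping.lookup \<beta> (Suc i) \<le> Poly_Mapping.lookup \<alpha> i \<and>
          Poly_Mapping.lookup \<alpha> i \<le> Poly_Mapping.lookup \<beta> i)"

text \<open>Subtraction of compositions is truncated on \<^typ>\<open>composition\<close>; differences such as
  \<open>\<lambda> - \<kappa>\<close>, which may have negative entries, are formed after embedding into integer sequences.\<close>

definition zcomp :: "composition \<Rightarrow> (nat \<Rightarrow>\<^sub>0 int)" where
  "zcomp \<alpha> = Poly_Mapping.map int \<alpha>"

lemma lookup_zcomp [simp]: "Poly_Mapping.lookup (zcomp \<alpha>) i = int (Poly_Mapping.lookup \<alpha> i)"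
  by (simp add: zcomp_def Poly_Mapping.map.rep_eq when_def)

lemma finite_bounded_compositions:
  assumes "finite A"
  shows "finite {a :: 'a \<Rightarrow>\<^sub>0 nat. Poly_Mapping.keys a \<subseteq> A \<and> (\<forall>i. Poly_Mapping.lookup a i \<le> K)}"
    (is "finite ?S")
proof -
  have "finite {f :: 'a \<Rightarrow> nat. \<forall>x. (x \<in> A \<longrightarrow> f x \<in> {..K}) \<and> (x \<notin> A \<longrightarrow> f x = 0)}"
    by (rule finite_set_of_finite_funs) (use assms in auto)
  moreover have "Poly_Mapping.lookup ` ?S \<subseteq>
      {f. \<forall>x. (x \<in> A \<longrightarrow> f x \<in> {..K}) \<and> (x \<notin> A \<longrightarrow> f x = 0)}"
    by (auto simp: in_keys_iff)
  ultimately have "finite (Poly_Mapping.lookup ` ?S)"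
    by (rule finite_subset[rotated])
  then show ?thesis
    by (rule finite_imageD) (simp add: inj_on_def)
qed

lemma csize_eq_sum:
  assumes "finite A" "Poly_Mapping.keys \<alpha> \<subseteq> A"
  shows "csize \<alpha> = (\<Sum>i\<in>A. Poly_Mapping.lookup \<alpha> i)"
  unfolding csize_def by (rule sum.mono_neutral_left) (use assms in \<open>auto simp: in_keys_iff\<close>)

lemma csize_add [simp]: "csize (\<alpha> + \<beta>) = csize \<alpha> + csize \<beta>"
proof -
  let ?A = "Poly_Mapping.keys \<alpha> \<union> Poly_Mapping.keys \<beta>"
  have "Poly_Mapping.keys (\<alpha> + \<beta>) \<subseteq> ?A"
    by (rule keys_add)
  then show ?thesis
    by (simp add: csize_eq_sum[of ?A] lookup_add sum.distrib)
qed

lemma csize_0 [simp]: "csize 0 = 0"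
  by (simp add: csize_def)

lemma lookup_le_csize: "Poly_Mapping.lookup \<alpha> i \<le> csize \<alpha>"
proof (cases "i \<in> Poly_Mapping.keys \<alpha>")
  case True
  then show ?thesis unfolding csize_def by (intro member_le_sum) auto
qed (simp add: in_keys_iff)

lemma finite_decompositions: "finite {(a, b). a + b = (m :: composition)}"
proof -
  let ?S = "{a :: composition. Poly_Mapping.keys a \<subseteq> Poly_Mapping.keys m \<and>
             (\<forall>i. Poly_Mapping.lookup a i \<le> csize m)}"
  have fin: "finite ?S" by (rule finite_bounded_compositions) simp
  have mem: "a \<in> ?S" if "a + b = m" for a b
  proof -
    have "Poly_Mapping.lookup a i \<le> Poly_Mapping.lookup m i" for i
      using that by (auto simp: lookup_add)
    moreover from this have "Poly_Mapping.keys a \<subseteq> Poly_Mapping.keys m"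
      using less_le_trans by (fastforce simp: in_keys_iff)
    ultimately show ?thesis using lookup_le_csize[of m] le_trans by blast
  qed
  have "{(a, b). a + b = m} \<subseteq> ?S \<times> ?S"
  proof
    fix p assume "p \<in> {(a, b). a + b = m}"
    then have "fst p + snd p = m" "snd p + fst p = m" by (auto simp: add.commute)
    then have "fst p \<in> ?S" "snd p \<in> ?S" using mem by blast+
    then show "p \<in> ?S \<times> ?S" by (simp add: mem_Times_iff)
  qed
  then show ?thesis using fin by (meson finite_SigmaI finite_subset)
qed


section \<open>Matrices\<close>

type_synonym matrix = "(nat \<times> nat) \<Rightarrow>\<^sub>0 nat"

definition mat_row :: "matrix \<Rightarrow> nat \<Rightarrow> composition" where
  "mat_row M i = Poly_Mapping.map_key (\<lambda>j. (i, j)) M"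

definition mat_col :: "matrix \<Rightarrow> nat \<Rightarrow> composition" where
  "mat_col M j = Poly_Mapping.map_key (\<lambda>i. (i, j)) M"

definition mat_transpose :: "matrix \<Rightarrow> matrix" where
  "mat_transpose M = Poly_Mapping.map_key prod.swap M"

lemma lookup_mat_row [simp]: "Poly_Mapping.lookup (mat_row M i) j = Poly_Mapping.lookup M (i, j)"
  by (simp add: mat_row_def map_key.rep_eq inj_def)

lemma lookup_mat_col [simp]: "Poly_Mapping.lookup (mat_col M j) i = Poly_Mapping.lookup M (i, j)"
  by (simp add: mat_col_def map_key.rep_eq inj_def)

lemma lookup_mat_transpose [simp]:
  "Poly_Mapping.lookup (mat_transpose M) (i, j) = Poly_Mapping.lookup M (j, i)"
  by (simp add: mat_transpose_def map_key.rep_eq)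

lift_definition row_sums :: "matrix \<Rightarrow> composition" is
  "\<lambda>M i. \<Sum>j | M (i, j) \<noteq> 0. M (i, j)"
proof -
  fix M :: "nat \<times> nat \<Rightarrow> nat"
  assume "finite {x. M x \<noteq> 0}"
  then have "finite (fst ` {x. M x \<noteq> 0})" by simp
  moreover have "{i. (\<Sum>j | M (i, j) \<noteq> 0. M (i, j)) \<noteq> 0} \<subseteq> fst ` {x. M x \<noteq> 0}"
  proof
    fix i assume "i \<in> {i. (\<Sum>j | M (i, j) \<noteq> 0. M (i, j)) \<noteq> 0}"
    then obtain j where "M (i, j) \<noteq> 0"
      using sum.not_neutral_contains_not_neutral by fastforce
    then show "i \<in> fst ` {x. M x \<noteq> 0}" by force
  qed
  ultimately show "finite {i. (\<Sum>j | M (i, j) \<noteq> 0. M (i, j)) \<noteq> 0}"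
    by (rule finite_subset[rotated])
qed

lift_definition col_sums :: "matrix \<Rightarrow> composition" is
  "\<lambda>M j. \<Sum>i | M (i, j) \<noteq> 0. M (i, j)"
proof -
  fix M :: "nat \<times> nat \<Rightarrow> nat"
  assume "finite {x. M x \<noteq> 0}"
  then have "finite (snd ` {x. M x \<noteq> 0})" by simp
  moreover have "{j. (\<Sum>i | M (i, j) \<noteq> 0. M (i, j)) \<noteq> 0} \<subseteq> snd ` {x. M x \<noteq> 0}"
  proof
    fix j assume "j \<in> {j. (\<Sum>i | M (i, j) \<noteq> 0. M (i, j)) \<noteq> 0}"
    then obtain i where "M (i, j) \<noteq> 0"
      using sum.not_neutral_contains_not_neutral by fastforce
    then show "j \<in> snd ` {x. M x \<noteq> 0}" by force
  qed
  ultimately show "finite {j. (\<Sum>i | M (i, j) \<noteq> 0. M (i, j)) \<noteq> 0}"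
    by (rule finite_subset[rotated])
qed

definition matrices :: "(nat \<Rightarrow>\<^sub>0 int) \<Rightarrow> (nat \<Rightarrow>\<^sub>0 int) \<Rightarrow> matrix set" where
  "matrices \<alpha> \<beta> = {M. zcomp (row_sums M) = \<alpha> \<and> zcomp (col_sums M) = \<beta>}"

lemma lookup_le_row_sums: "Poly_Mapping.lookup M (i, j) \<le> Poly_Mapping.lookup (row_sums M) i"
proof (cases "Poly_Mapping.lookup M (i, j) = 0")
  case False
  have "finite {j. Poly_Mapping.lookup M (i, j) \<noteq> 0}"
    using finite_lookup[of "mat_row M i"] by simp
  then show ?thesis
    using False member_le_sum[of j "{j. Poly_Mapping.lookup M (i, j) \<noteq> 0}"
      "\<lambda>j. Poly_Mapping.lookup M (i, j)"]
    by (auto simp: row_sums.rep_eq)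
qed simp

lemma lookup_le_col_sums: "Poly_Mapping.lookup M (i, j) \<le> Poly_Mapping.lookup (col_sums M) j"
proof (cases "Poly_Mapping.lookup M (i, j) = 0")
  case False
  have "finite {i. Poly_Mapping.lookup M (i, j) \<noteq> 0}"
    using finite_lookup[of "mat_col M j"] by simp
  then show ?thesis
    using False member_le_sum[of i "{i. Poly_Mapping.lookup M (i, j) \<noteq> 0}"
      "\<lambda>i. Poly_Mapping.lookup M (i, j)"]
    by (auto simp: col_sums.rep_eq)
qed simp

lemma finite_dominated_matrices:
  assumes "\<And>M i j. M \<in> S \<Longrightarrow> int (Poly_Mapping.lookup M (i, j)) \<le> Poly_Mapping.lookup \<alpha> i"
    and "\<And>M i j. M \<in> S \<Longrightarrow> int (Poly_Mapping.lookup M (i, j)) \<le> Poly_Mapping.lookup \<beta> j"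
  shows "finite (S :: matrix set)"
proof -
  let ?I = "Poly_Mapping.keys \<alpha>" and ?J = "Poly_Mapping.keys \<beta>"
  define K where "K = (\<Sum>i\<in>?I. nat \<bar>Poly_Mapping.lookup \<alpha> i\<bar>)"
  have "Poly_Mapping.keys M \<subseteq> ?I \<times> ?J \<and> (\<forall>p. Poly_Mapping.lookup M p \<le> K)" if M: "M \<in> S" for M
  proof -
    have nz: "i \<in> ?I \<and> j \<in> ?J" if "Poly_Mapping.lookup M (i, j) \<noteq> 0" for i j
      using that assms[OF M, of i j] by (auto simp: in_keys_iff)
    have "Poly_Mapping.lookup M (i, j) \<le> K" for i j
    proof (cases "Poly_Mapping.lookup M (i, j) = 0")
      case False
      then have "i \<in> ?I" using nz by blast
      then have "nat \<bar>Poly_Mapping.lookup \<alpha> i\<bar> \<le> K"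
        unfolding K_def by (intro member_le_sum) auto
      then show ?thesis using assms(1)[OF M, of i j] by linarith
    qed simp
    then show ?thesis using nz by (auto simp: in_keys_iff)
  qed
  then have "S \<subseteq> {M. Poly_Mapping.keys M \<subseteq> ?I \<times> ?J \<and> (\<forall>p. Poly_Mapping.lookup M p \<le> K)}"
    by blast
  moreover have "finite \<dots>" by (rule finite_bounded_compositions) simp
  ultimately show ?thesis by (rule finite_subset)
qed

lemma finite_matrices: "finite (matrices \<alpha> \<beta>)"
proof (rule finite_dominated_matrices)
  fix M i j assume "M \<in> matrices \<alpha> \<beta>"
  then have "\<alpha> = zcomp (row_sums M)" "\<beta> = zcomp (col_sums M)"
    by (auto simp: matrices_def)
  then show "int (Poly_Mapping.lookup M (i, j)) \<le> Poly_Mapping.lookup \<alpha> i"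
    and "int (Poly_Mapping.lookup M (i, j)) \<le> Poly_Mapping.lookup \<beta> j"
    using lookup_le_row_sums[of M i j] lookup_le_col_sums[of M i j] by simp_all
qed


section \<open>Tableaux\<close>

definition semistandard_tableau ::
    "composition \<Rightarrow> composition \<Rightarrow> (nat \<Rightarrow> composition) \<Rightarrow> bool" where
  "semistandard_tableau lam \<mu> T \<longleftrightarrow>
     (\<forall>i. T i \<in> partitions) \<and> T 0 = \<mu> \<and> (\<forall>i. T i \<leftharpoondown> T (Suc i)) \<and>
     (\<exists>N\<^sub>0. \<forall>N\<ge>N\<^sub>0. T N = lam)"

definition integral_encoding :: "(nat \<Rightarrow> composition) \<Rightarrow> matrix \<Rightarrow> bool" where
  "integral_encoding T M \<longleftrightarrow>
     (\<forall>i j. int (Poly_Mapping.lookup M (i, j)) =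
        Poly_Mapping.lookup (zcomp (T (Suc j)) - zcomp (T j)) i)"

definition Tabl :: "composition \<Rightarrow> composition \<Rightarrow> matrix set" where
  "Tabl lam \<mu> = {M. \<exists>T. semistandard_tableau lam \<mu> T \<and> integral_encoding T M}"

lemma Tabl_entry_le:
  assumes "M \<in> Tabl lam \<mu>"
  shows "int (Poly_Mapping.lookup M (i, j)) \<le> Poly_Mapping.lookup (zcomp lam) i"
proof -
  obtain T N\<^sub>0 where T: "\<And>i. T i \<leftharpoondown> T (Suc i)" "\<And>N. N \<ge> N\<^sub>0 \<Longrightarrow> T N = lam"
    and M: "integral_encoding T M"
    using assms by (auto simp: Tabl_def semistandard_tableau_def)
  have "Poly_Mapping.lookup (T k) i \<le> Poly_Mapping.lookup (T (Suc k)) i" for k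
    using T(1)[of k] by (simp add: interlaces_def)
  then have "Poly_Mapping.lookup (T (Suc j)) i \<le> Poly_Mapping.lookup (T (max N\<^sub>0 (Suc j))) i"
    by (rule lift_Suc_mono_le[of "\<lambda>k. Poly_Mapping.lookup (T k) i"]) auto
  then show ?thesis
    using T(2)[of "max N\<^sub>0 (Suc j)"] M by (simp add: integral_encoding_def lookup_minus)
qed

text \<open>Since \<^const>\<open>Sum_any\<close> is 0 for infinite support, note that the sum of
  \<open>[M \<in> Tabl(\<lambda>/\<kappa>)] [M\<^sup>t \<in> Tabl(\<nu>/\<mu>)]\<close> over all matrices has finite support:\<close>

lemma finite_Tabl_pairs: "finite {M. M \<in> Tabl lam \<kappa> \<and> mat_transpose M \<in> Tabl \<nu> \<mu>}"
proof (rule finite_dominated_matrices)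
  fix M i j assume M: "M \<in> {M. M \<in> Tabl lam \<kappa> \<and> mat_transpose M \<in> Tabl \<nu> \<mu>}"
  show "int (Poly_Mapping.lookup M (i, j)) \<le> Poly_Mapping.lookup (zcomp lam) i"
    using M Tabl_entry_le by blast
  show "int (Poly_Mapping.lookup M (i, j)) \<le> Poly_Mapping.lookup (zcomp \<nu>) j"
    using M Tabl_entry_le[of "mat_transpose M" \<nu> \<mu> j i] by simp
qed


section \<open>The ring of symmetric functions\<close>

text \<open>A formal power series over the integers in \<open>X\<^sub>0, X\<^sub>1, \<dots>\<close> is the function that maps
  the exponent vector of each monomial to its coefficient.\<close>

typedef symfun =
  "{f :: composition \<Rightarrow> int.
     (\<forall>\<pi> m. bij \<pi> \<longrightarrow> f (Poly_Mapping.map_key \<pi> m) = f m) \<and>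
     (\<exists>d. \<forall>m. f m \<noteq> 0 \<longrightarrow> csize m \<le> d)}"
  morphisms sf_coeff Abs_symfun
  by (rule exI[of _ "\<lambda>_. 0"]) simp

setup_lifting type_definition_symfun

lemma symfun_eqI: "(\<And>m. sf_coeff f m = sf_coeff g m) \<Longrightarrow> f = g"
  by (metis ext sf_coeff_inject)

lemma map_key_bij_inv:
  assumes "bij \<pi>"
  shows "Poly_Mapping.map_key \<pi> (Poly_Mapping.map_key (inv \<pi>) m) = m"
    and "Poly_Mapping.map_key (inv \<pi>) (Poly_Mapping.map_key \<pi> m) = m"
  using assms
  by (auto intro!: poly_mapping_eqI
      simp: map_key.rep_eq bij_is_inj bij_imp_bij_inv bij_is_surj surj_f_inv_f)

instantiation symfun :: comm_ring_1
begin

lift_definition zero_symfun :: symfun is "\<lambda>_. 0" by simp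

lift_definition one_symfun :: symfun is "\<lambda>m. of_bool (m = 0)"
proof (intro conjI allI impI)
  fix \<pi> :: "nat \<Rightarrow> nat" and m :: composition
  assume "bij \<pi>"
  then have "Poly_Mapping.map_key \<pi> m = 0 \<longleftrightarrow> m = 0"
    using map_key_bij_inv(2)[of \<pi> m] bij_imp_bij_inv[of \<pi>] by (auto simp: bij_is_inj)
  then show "(of_bool (Poly_Mapping.map_key \<pi> m = 0) :: int) = of_bool (m = 0)" by simp
qed (auto intro!: exI[of _ 0] simp: csize_def)

lift_definition uminus_symfun :: "symfun \<Rightarrow> symfun" is "\<lambda>f m. - f m" by simp

lift_definition plus_symfun :: "symfun \<Rightarrow> symfun \<Rightarrow> symfun" is "\<lambda>f g m. f m + g m"
proof (elim conjE exE, intro conjI)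
  fix f g :: "composition \<Rightarrow> int" and d e
  assume "\<forall>m. f m \<noteq> 0 \<longrightarrow> csize m \<le> d" "\<forall>m. g m \<noteq> 0 \<longrightarrow> csize m \<le> e"
  then show "\<exists>d. \<forall>m. f m + g m \<noteq> 0 \<longrightarrow> csize m \<le> d"
    by (intro exI[of _ "max d e"]) (metis add_0 le_max_iff_disj)
qed simp

lift_definition minus_symfun :: "symfun \<Rightarrow> symfun \<Rightarrow> symfun" is "\<lambda>f g m. f m - g m"
proof (elim conjE exE, intro conjI)
  fix f g :: "composition \<Rightarrow> int" and d e
  assume "\<forall>m. f m \<noteq> 0 \<longrightarrow> csize m \<le> d" "\<forall>m. g m \<noteq> 0 \<longrightarrow> csize m \<le> e"
  then show "\<exists>d. \<forall>m. f m - g m \<noteq> 0 \<longrightarrow> csize m \<le> d"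
    by (intro exI[of _ "max d e"]) (metis diff_self le_max_iff_disj)
qed simp

lift_definition times_symfun :: "symfun \<Rightarrow> symfun \<Rightarrow> symfun" is
  "\<lambda>f g m. \<Sum>(a, b) | a + b = m. f a * g b"
proof (elim conjE exE, intro conjI allI impI)
  fix f g :: "composition \<Rightarrow> int" and d e
  assume "\<forall>m. f m \<noteq> 0 \<longrightarrow> csize m \<le> d" "\<forall>m. g m \<noteq> 0 \<longrightarrow> csize m \<le> e"
  then have "csize m \<le> d + e" if nz: "(\<Sum>(a, b) | a + b = m. f a * g b) \<noteq> 0" for m
  proof -
    obtain p where "p \<in> {(a, b). a + b = m}" "(case p of (a, b) \<Rightarrow> f a * g b) \<noteq> 0"
      using nz by (rule sum.not_neutral_contains_not_neutral)
    then obtain a b where "a + b = m" "f a * g b \<noteq> 0" by (cases p) simp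
    then have "csize a \<le> d" "csize b \<le> e"
      using \<open>\<forall>m. f m \<noteq> 0 \<longrightarrow> csize m \<le> d\<close> \<open>\<forall>m. g m \<noteq> 0 \<longrightarrow> csize m \<le> e\<close> by auto
    with \<open>a + b = m\<close> show ?thesis by auto
  qed
  then show "\<exists>d. \<forall>m. (\<Sum>(a, b) | a + b = m. f a * g b) \<noteq> 0 \<longrightarrow> csize m \<le> d" by blast
next
  fix f g :: "composition \<Rightarrow> int" and \<pi> :: "nat \<Rightarrow> nat" and m :: composition
  assume f: "\<forall>\<pi> m. bij \<pi> \<longrightarrow> f (Poly_Mapping.map_key \<pi> m) = f m"
    and g: "\<forall>\<pi> m. bij \<pi> \<longrightarrow> g (Poly_Mapping.map_key \<pi> m) = g m" and \<pi>: "bij \<pi>"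
  let ?p = "Poly_Mapping.map_key \<pi> :: composition \<Rightarrow> composition"
  let ?q = "Poly_Mapping.map_key (inv \<pi>) :: composition \<Rightarrow> composition"
  have inj: "inj \<pi>" "inj (inv \<pi>)"
    using \<pi> by (simp_all add: bij_is_inj bij_imp_bij_inv)
  show "(\<Sum>(a, b) | a + b = ?p m. f a * g b) = (\<Sum>(a, b) | a + b = m. f a * g b)"
    by (rule sum.reindex_bij_witness[of _ "\<lambda>(a, b). (?p a, ?p b)" "\<lambda>(a, b). (?q a, ?q b)"])
      (use \<pi> f g in \<open>auto simp: map_key_bij_inv map_key_plus[OF inj(1), symmetric]
         map_key_plus[OF inj(2), symmetric] bij_imp_bij_inv\<close>)
qed

instance
proof
  fix f g h :: symfun
  show "f + g + h = f + (g + h)" "f + g = g + f" "0 + f = f" "- f + f = 0" "f - g = f + - g"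
    by (transfer; simp add: fun_eq_iff)+
  show "(0 :: symfun) \<noteq> 1" by transfer (auto dest: fun_cong[of _ _ 0])
  show "(f + g) * h = f * h + g * h"
    by transfer (simp add: fun_eq_iff sum.distrib[symmetric] algebra_simps case_prod_unfold)
  show "f * g = g * f"
  proof (transfer, rule ext)
    fix f g :: "composition \<Rightarrow> int" and m :: composition
    show "(\<Sum>(a, b) | a + b = m. f a * g b) = (\<Sum>(a, b) | a + b = m. g a * f b)"
      by (rule sum.reindex_bij_witness[of _ prod.swap prod.swap]) (auto simp: add.commute)
  qed
  show "1 * f = f"
  proof (transfer, rule ext)
    fix f :: "composition \<Rightarrow> int" and m :: composition
    have "(\<Sum>(a, b) | a + b = m. of_bool (a = 0) * f b) =
        (\<Sum>(a, b)\<in>{(0 :: composition, m)}. of_bool (a = 0) * f b)"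
      by (rule sum.mono_neutral_right) (auto simp: finite_decompositions)
    then show "(\<Sum>(a, b) | a + b = m. of_bool (a = 0) * f b) = f m" by simp
  qed
  show "f * g * h = f * (g * h)"
  proof (transfer, rule ext)
    fix f g h :: "composition \<Rightarrow> int" and m :: composition
    let ?D = "\<lambda>m :: composition. {(a, b). a + b = m}"
    have "(\<Sum>(x, c)\<in>?D m. (\<Sum>(a, b)\<in>?D x. f a * g b) * h c) =
        (\<Sum>((x, c), (a, b))\<in>Sigma (?D m) (\<lambda>(x, c). ?D x). f a * g b * h c)"
      by (subst sum.Sigma[symmetric])
        (auto simp: finite_decompositions sum_distrib_right case_prod_unfold
          intro: finite_decompositions[unfolded case_prod_unfold])
    also have "\<dots> = (\<Sum>((a, y), (b, c))\<in>Sigma (?D m) (\<lambda>(a, y). ?D y). f a * (g b * h c))"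
      by (rule sum.reindex_bij_witness[of _ "\<lambda>((a, y), (b, c)). ((a + b, c), (a, b))"
            "\<lambda>((x, c), (a, b)). ((a, b + c), (b, c))"]) (auto simp: algebra_simps)
    also have "\<dots> = (\<Sum>(a, y)\<in>?D m. f a * (\<Sum>(b, c)\<in>?D y. g b * h c))"
      by (subst sum.Sigma[symmetric])
        (auto simp: finite_decompositions sum_distrib_left case_prod_unfold
          intro: finite_decompositions[unfolded case_prod_unfold])
    finally show "(\<Sum>(x, c)\<in>?D m. (\<Sum>(a, b)\<in>?D x. f a * g b) * h c) =
        (\<Sum>(a, y)\<in>?D m. f a * (\<Sum>(b, c)\<in>?D y. g b * h c))" .
  qed
qed

end


section \<open>Schur functions\<close>

type_synonym zpoly = "composition \<Rightarrow>\<^sub>0 int"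

definition indet :: "nat \<Rightarrow> zpoly" where
  "indet i = Poly_Mapping.single (Poly_Mapping.single i 1) 1"

text \<open>\<open>truncate_vars n f\<close> is the polynomial obtained from \<open>f\<close> by setting \<open>X\<^sub>i = 0\<close> for all \<open>i \<ge> n\<close>.\<close>

lift_definition truncate_vars :: "nat \<Rightarrow> symfun \<Rightarrow> zpoly" is
  "\<lambda>n f m. if m \<in> compositions_upto n then f m else 0"
proof (elim conjE exE)
  fix n d and f :: "composition \<Rightarrow> int"
  assume d: "\<forall>m. f m \<noteq> 0 \<longrightarrow> csize m \<le> d"
  have "{m. (if m \<in> compositions_upto n then f m else 0) \<noteq> 0} \<subseteq>
      {m. Poly_Mapping.keys m \<subseteq> {..<n} \<and> (\<forall>i. Poly_Mapping.lookup m i \<le> d)}"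
  proof
    fix m assume "m \<in> {m. (if m \<in> compositions_upto n then f m else 0) \<noteq> 0}"
    then have m: "m \<in> compositions_upto n" "f m \<noteq> 0" by (auto split: if_splits)
    then have "Poly_Mapping.keys m \<subseteq> {..<n}"
      unfolding compositions_upto_def in_keys_iff subset_iff lessThan_iff mem_Collect_eq
      by (metis not_le)
    moreover have "Poly_Mapping.lookup m i \<le> d" for i
      using lookup_le_csize[of m i] d m(2) by (meson le_trans)
    ultimately show "m \<in> {m. Poly_Mapping.keys m \<subseteq> {..<n} \<and>
        (\<forall>i. Poly_Mapping.lookup m i \<le> d)}" by blast
  qed
  then show "finite {m. (if m \<in> compositions_upto n then f m else 0) \<noteq> 0}"
    using finite_bounded_compositions[of "{..<n}" d] finite_subset by blast
qed

definition alternant :: "nat \<Rightarrow> composition \<Rightarrow> zpoly" where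
  "alternant n \<alpha> =
     (\<Sum>\<sigma> | \<sigma> permutes {..<n}. of_int (sign \<sigma>) * (\<Prod>i<n. indet (\<sigma> i) ^ Poly_Mapping.lookup \<alpha> i))"

definition staircase :: "nat \<Rightarrow> composition" where
  "staircase n = Poly_Mapping.nth (rev [0..<n])"

text \<open>Polynomials form an integral domain and \<open>alternant n (staircase n)\<close>, the Vandermonde
  determinant, is nonzero, so that the quotient below is unique.\<close>

definition schur_poly :: "nat \<Rightarrow> composition \<Rightarrow> zpoly" where
  "schur_poly n \<alpha> =
     (if \<alpha> \<in> compositions_upto n
      then THE q. q * alternant n (staircase n) = alternant n (staircase n + \<alpha>)
      else 0)"

definition schur :: "composition \<Rightarrow> symfun" where
  "schur \<alpha> = (THE f. \<forall>n. truncate_vars n f = schur_poly n \<alpha>)"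

text \<open>\<open>\<int>\<close>-bilinearity is additivity in each argument.\<close>

definition scalar_prod :: "symfun \<Rightarrow> symfun \<Rightarrow> int" where
  "scalar_prod =
     (THE B. (\<forall>f. additive (B f)) \<and> (\<forall>g. additive (\<lambda>f. B f g)) \<and>
        (\<forall>lam\<in>partitions. \<forall>\<mu>\<in>partitions. B (schur lam) (schur \<mu>) = of_bool (lam = \<mu>)))"

definition skew_schur :: "composition \<Rightarrow> composition \<Rightarrow> symfun" where
  "skew_schur lam \<mu> = (THE h. \<forall>f. scalar_prod h f = scalar_prod (schur lam) (schur \<mu> * f))"

end

(* Multiply the generating series S(lam/kappa) of semistandard tableaux by the alternant of
   delta + mu: this gives the sum of the alternants of delta + mu + wt(T) over all tableaux T of
   shape lam/kappa. The tableaux for which the rows of the encoding do not build up a tableau of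
   shape nu/mu cancel: at the first violation in reading order (row k, letters j, j+1) toggle the
   partition T(j+1) from that place on. This exchanges two adjacent exponents, so the alternant
   changes its sign. What remains gives s(mu) S(lam/kappa) = sum over nu of c(lam/kappa, nu/mu) s(nu),
   where c(lam/kappa, nu/mu) is the number of matrices on the right-hand side of the theorem.
   The same toggle without a restriction on the rows is the Bender-Knuth involution, which shows
   that S(lam/kappa) is symmetric.

   For kappa = mu = 0 only diagonal matrices contribute, whence S(lam/0) = s(lam). As c is invariant
   under transposition of matrices, <S(lam/kappa), s(nu)> = c(lam/kappa, nu/0) = c(nu/0, lam/kappa)
   = <s(lam), s(kappa) s(nu)>, whence S(lam/kappa) is the skew Schur function. Finally
   <s(lam/kappa), s(nu/mu)> = <s(nu), s(mu) S(lam/kappa)> = c(lam/kappa, nu/mu). *)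

theory Submission
  imports Defs
begin

text \<open>Two demands shape the toggle. It has to undo itself, so the first violation must stay
  where it is: T(j+1) changes in rows from k on only, and the tests at earlier places never look at
  these entries. It also has to exchange the exponents j and j+1 exactly, although it acts on a part
  of the tableau. Hence the cut inside row k: as neighbouring entries of \<delta> differ by 1, the
  contributions of \<delta>, \<mu> and the letters read so far are equal at j and j+1 right after
  the letter j+1 with which the inequality first fails; behind it, the toggle exchanges the numbers
  of unread letters j and j+1.

  Schur functions, skew Schur functions and the scalar product are given by definite descriptions,
  so each comes with existence and uniqueness to prove. Tableau series are the witnesses for the
  first two. Coefficients in the Schur basis are read off after multiplication by the Vandermonde
  determinant; that Schur functions span is proved separately, from unitriangularity.\<close>

abbreviation (input) lookup :: "('a \<Rightarrow>\<^sub>0 'b::zero) \<Rightarrow> 'a \<Rightarrow> 'b" where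
  "lookup \<equiv> Poly_Mapping.lookup"

section \<open>Interlacing, size and length of compositions\<close>

lemma interlacesD:
  assumes "\<alpha> \<leftharpoondown> \<beta>"
  shows "\<alpha> \<in> partitions" "\<beta> \<in> partitions"
    "lookup \<beta> (Suc i) \<le> lookup \<alpha> i" "lookup \<alpha> i \<le> lookup \<beta> i"
  using assms by (auto simp: interlaces_def)

text \<open>Consecutive chains of inequalities link up, so both sequences decrease; interlacing can
  thus be verified row by row.\<close>

lemma interlaces_iff:
  "\<alpha> \<leftharpoondown> \<beta> \<longleftrightarrow> (\<forall>i. lookup \<beta> (Suc i) \<le> lookup \<alpha> i \<and> lookup \<alpha> i \<le> lookup \<beta> i)"
  unfolding interlaces_def partitions_def mem_Collect_eq by (meson le_trans)

lemma csize_mono: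
  assumes "\<And>i. lookup \<alpha> i \<le> lookup \<beta> i"
  shows "csize \<alpha> \<le> csize \<beta>"
proof -
  have "Poly_Mapping.keys \<alpha> \<subseteq> Poly_Mapping.keys \<beta>"
    using assms le_zero_eq unfolding subset_iff in_keys_iff by metis
  then have "csize \<alpha> = (\<Sum>i\<in>Poly_Mapping.keys \<beta>. lookup \<alpha> i)"
    by (simp add: csize_eq_sum)
  also have "\<dots> \<le> csize \<beta>"
    unfolding csize_def by (intro sum_mono assms)
  finally show ?thesis .
qed

text \<open>Turns size counts into equalities, both for successive stages of one tableau and for
  comparison with the diagonal tableau.\<close>

lemma csize_eq_imp_eq:
  assumes "\<And>i. lookup \<alpha> i \<le> lookup \<beta> i" "csize \<alpha> = csize \<beta>"
  shows "\<alpha> = \<beta>"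
proof -
  have eq: "\<beta> = \<alpha> + (\<beta> - \<alpha>)"
    using assms(1) by (intro poly_mapping_eqI) (simp add: lookup_add lookup_minus)
  then have "csize (\<beta> - \<alpha>) = 0"
    using assms(2) by (metis add_cancel_left_right csize_add)
  then have "lookup (\<beta> - \<alpha>) i = 0" for i
    using lookup_le_csize[of "\<beta> - \<alpha>" i] by simp
  then have "\<beta> - \<alpha> = 0"
    by (intro poly_mapping_eqI) simp
  then show ?thesis using eq by simp
qed

lemma partitions_antimono:
  assumes "\<alpha> \<in> partitions" "i \<le> j"
  shows "lookup \<alpha> j \<le> lookup \<alpha> i"
  by (rule lift_Suc_antimono_le[OF _ assms(2), of "lookup \<alpha>"])
    (use assms(1) in \<open>simp add: partitions_def\<close>)

lemma composition_bound:
  obtains n where "\<alpha> \<in> compositions_upto n"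
proof
  show "\<alpha> \<in> compositions_upto (Suc (Max (insert 0 (Poly_Mapping.keys \<alpha>))))"
    unfolding compositions_upto_def
  proof (safe)
    fix i assume "Suc (Max (insert 0 (Poly_Mapping.keys \<alpha>))) \<le> i"
    then have "i \<notin> Poly_Mapping.keys \<alpha>"
      by (meson Max_ge Suc_n_not_le_n finite_insert finite_keys insertI2 le_trans)
    then show "lookup \<alpha> i = 0" by (simp add: in_keys_iff)
  qed
qed

lemma compositions_upto_mono: "m \<le> n \<Longrightarrow> compositions_upto m \<subseteq> compositions_upto n"
  by (auto simp: compositions_upto_def)

lemma add_upto_iff [simp]:
  "\<alpha> + \<beta> \<in> compositions_upto n \<longleftrightarrow> \<alpha> \<in> compositions_upto n \<and> \<beta> \<in> compositions_upto n"
  by (auto simp: compositions_upto_def lookup_add)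

lemma csize_upto:
  assumes "\<alpha> \<in> compositions_upto n"
  shows "csize \<alpha> = (\<Sum>i<n. lookup \<alpha> i)"
proof (rule csize_eq_sum)
  show "Poly_Mapping.keys \<alpha> \<subseteq> {..<n}"
    using assms unfolding compositions_upto_def subset_iff in_keys_iff lessThan_iff mem_Collect_eq
    by (metis not_le)
qed simp

text \<open>A nonzero part in row i forces i + 1 nonzero parts, hence size at least i + 1. This
  makes \<open>csize \<nu>\<close> a sufficient number of variables in
  \<open>schur_coeff\<close>.\<close>

lemma partitions_in_upto_csize:
  assumes "\<alpha> \<in> partitions"
  shows "\<alpha> \<in> compositions_upto (csize \<alpha>)"
proof -
  have False if "lookup \<alpha> i \<noteq> 0" "csize \<alpha> \<le> i" for i
  proof -
    have "Suc i = (\<Sum>j\<le>i. 1)" by simp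
    also have "\<dots> \<le> (\<Sum>j\<le>i. lookup \<alpha> j)"
    proof (rule sum_mono)
      fix j assume "j \<in> {..i}"
      then show "1 \<le> lookup \<alpha> j"
        using that(1) partitions_antimono[OF assms, of j i] by simp
    qed
    also have "\<dots> \<le> csize \<alpha>"
    proof -
      obtain n where n: "\<alpha> \<in> compositions_upto n" by (rule composition_bound)
      then have "\<alpha> \<in> compositions_upto (max n (Suc i))"
        using compositions_upto_mono[of n "max n (Suc i)"] by auto
      then show ?thesis by (auto simp: csize_upto intro!: sum_mono2)
    qed
    finally show False using that(2) by simp
  qed
  then show ?thesis by (auto simp: compositions_upto_def)
qed

section \<open>Toggling the middle one of three interlacing partitions\<close>

text \<open>Rows from k on are reflected in the interval that interlacing leaves for them, with
  right end b in row k. The index \<open>i - 1\<close> occurs for i > k only, so it is never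
  truncated; the difference is exact whenever \<beta> lies in these intervals.\<close>

lift_definition toggle :: "composition \<Rightarrow> composition \<Rightarrow> nat \<Rightarrow> nat \<Rightarrow> composition \<Rightarrow> composition" is
  "\<lambda>\<alpha> \<gamma> k b \<beta> i. if i < k then \<beta> i
     else max (\<alpha> i) (\<gamma> (Suc i)) + (if i = k then b else min (\<alpha> (i - 1)) (\<gamma> i)) - \<beta> i"
proof -
  fix \<alpha> \<gamma> \<beta> :: "nat \<Rightarrow> nat" and k b
  assume fin: "finite {x. \<alpha> x \<noteq> 0}" "finite {x. \<gamma> x \<noteq> 0}" "finite {x. \<beta> x \<noteq> 0}"
  have "finite (Suc -` {x. \<gamma> x \<noteq> 0})"
    using fin(2) by (intro finite_vimageI) auto
  then have "finite ({..k} \<union> {x. \<alpha> x \<noteq> 0} \<union> {x. \<gamma> x \<noteq> 0} \<union> Suc -` {x. \<gamma> x \<noteq> 0})"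
    using fin by simp
  then show "finite {i. (if i < k then \<beta> i
     else max (\<alpha> i) (\<gamma> (Suc i)) + (if i = k then b else min (\<alpha> (i - 1)) (\<gamma> i)) - \<beta> i) \<noteq> 0}"
    by (rule rev_finite_subset) (auto split: if_splits)
qed

text \<open>The interval for row k is shortened to end at b, but still contains the entry of
  \<beta>. Row 0 has no row above it, hence the condition \<open>k > 0\<close>.\<close>

locale toggling =
  fixes \<alpha> \<beta> \<gamma> :: composition and k b :: nat
  assumes interlaces: "\<alpha> \<leftharpoondown> \<beta>" "\<beta> \<leftharpoondown> \<gamma>"
    and bound: "lookup \<beta> k \<le> b" "b \<le> lookup \<gamma> k" "k > 0 \<Longrightarrow> b \<le> lookup \<alpha> (k - 1)"
begin

definition upper :: "nat \<Rightarrow> nat" where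
  "upper i = (if i = k then b else min (lookup \<alpha> (i - 1)) (lookup \<gamma> i))"

definition lower :: "nat \<Rightarrow> nat" where
  "lower i = max (lookup \<alpha> i) (lookup \<gamma> (Suc i))"

lemma lookup_toggle:
  "lookup (toggle \<alpha> \<gamma> k b \<beta>) i = (if i < k then lookup \<beta> i else lower i + upper i - lookup \<beta> i)"
  by (simp add: toggle.rep_eq lower_def upper_def)

lemma between:
  assumes "k \<le> i"
  shows "lower i \<le> lookup \<beta> i" "lookup \<beta> i \<le> upper i"
  using assms interlacesD(3,4)[OF interlaces(1), of i] interlacesD(3,4)[OF interlaces(2), of i]
    interlacesD(3)[OF interlaces(1), of "i - 1"] bound
  by (auto simp: lower_def upper_def)

lemma toggle_between:
  assumes "k \<le> i"
  shows "lower i \<le> lookup (toggle \<alpha> \<gamma> k b \<beta>) i" "lookup (toggle \<alpha> \<gamma> k b \<beta>) i \<le> upper i"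
  using between[OF assms] assms by (simp_all add: lookup_toggle)

lemma upper_le:
  "upper i \<le> lookup \<gamma> i" "k \<le> Suc i \<Longrightarrow> upper (Suc i) \<le> lookup \<alpha> i"
  using bound by (auto simp: upper_def)

lemma toggle_interlaces: "\<alpha> \<leftharpoondown> toggle \<alpha> \<gamma> k b \<beta>" "toggle \<alpha> \<gamma> k b \<beta> \<leftharpoondown> \<gamma>"
proof -
  let ?t = "toggle \<alpha> \<gamma> k b \<beta>"
  have "lookup ?t (Suc i) \<le> lookup \<alpha> i \<and> lookup \<alpha> i \<le> lookup ?t i \<and>
      lookup \<gamma> (Suc i) \<le> lookup ?t i \<and> lookup ?t i \<le> lookup \<gamma> i" for i
  proof (intro conjI)
    show "lookup ?t (Suc i) \<le> lookup \<alpha> i"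
      using interlacesD(3)[OF interlaces(1), of i] toggle_between(2)[of "Suc i"] upper_le(2)[of i]
      by (cases "Suc i < k") (auto simp: lookup_toggle[of "Suc i"] not_less)
    show "lookup \<alpha> i \<le> lookup ?t i" "lookup \<gamma> (Suc i) \<le> lookup ?t i" "lookup ?t i \<le> lookup \<gamma> i"
      using interlacesD(4)[OF interlaces(1), of i] interlacesD(3,4)[OF interlaces(2), of i]
        toggle_between[of i] upper_le(1)[of i]
      by (cases "i < k"; force simp: lookup_toggle[of i] lower_def not_less)+
  qed
  then show "\<alpha> \<leftharpoondown> ?t" "?t \<leftharpoondown> \<gamma>" by (auto simp: interlaces_iff)
qed

lemma toggle_bound: "lookup (toggle \<alpha> \<gamma> k b \<beta>) k \<le> b"
  using toggle_between(2)[of k] by (simp add: upper_def)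

lemma toggle_toggle: "toggle \<alpha> \<gamma> k b (toggle \<alpha> \<gamma> k b \<beta>) = \<beta>"
proof (rule poly_mapping_eqI)
  fix i
  have "lookup (toggle \<alpha> \<gamma> k b (toggle \<alpha> \<gamma> k b \<beta>)) i =
     (if i < k then lookup (toggle \<alpha> \<gamma> k b \<beta>) i
      else lower i + upper i - lookup (toggle \<alpha> \<gamma> k b \<beta>) i)"
    by (simp add: toggle.rep_eq lower_def upper_def)
  then show "lookup (toggle \<alpha> \<gamma> k b (toggle \<alpha> \<gamma> k b \<beta>)) i = lookup \<beta> i"
    using between[of i] by (auto simp: lookup_toggle)
qed

text \<open>Neighbouring rows telescope: \<open>lower n\<close> and \<open>upper (Suc n)\<close> are
  the maximum and the minimum of the same two numbers.\<close>

lemma sum_lower_upper: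
  "k \<le> n \<Longrightarrow> (\<Sum>i=k..n. lower i + upper i) =
     b + (\<Sum>i=k..<n. lookup \<alpha> i + lookup \<gamma> (Suc i)) + lower n"
proof (induction n rule: dec_induct)
  case base
  then show ?case by (simp add: upper_def)
next
  case (step n)
  have "lower n + upper (Suc n) = lookup \<alpha> n + lookup \<gamma> (Suc n)"
    using step by (auto simp: lower_def upper_def)
  with step show ?case by simp
qed

text \<open>By reflection, the sum of the old and the new middle partition in rows from k on does
  not depend on \<beta>. For k = 0 and b the first part of \<gamma>, this says that the two letters
  exchange their multiplicities.\<close>

lemma csize_toggle:
  "csize \<beta> + csize (toggle \<alpha> \<gamma> k b \<beta>) + (\<Sum>i\<le>k. lookup \<gamma> i) + (\<Sum>i<k. lookup \<alpha> i) =
     2 * (\<Sum>i<k. lookup \<beta> i) + csize \<alpha> + csize \<gamma> + b"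
proof -
  let ?t = "toggle \<alpha> \<gamma> k b \<beta>"
  obtain n where "\<gamma> \<in> compositions_upto n" by (rule composition_bound)
  define N where "N = max n (Suc k)"
  have N: "k < N" "\<gamma> \<in> compositions_upto N"
    using \<open>\<gamma> \<in> compositions_upto n\<close> compositions_upto_mono[of n N] by (auto simp: N_def)
  have le: "lookup \<beta> i \<le> lookup \<gamma> i" "lookup \<alpha> i \<le> lookup \<gamma> i" "lookup ?t i \<le> lookup \<gamma> i" for i
    using interlacesD(4)[OF interlaces(1), of i] interlacesD(4)[OF interlaces(2), of i]
      interlacesD(4)[OF toggle_interlaces(2), of i] by auto
  have upto: "\<alpha> \<in> compositions_upto N" "\<beta> \<in> compositions_upto N" "?t \<in> compositions_upto N"
    using N(2) le le_zero_eq unfolding compositions_upto_def mem_Collect_eq by metis+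
  have split: "(\<Sum>i<Suc N. f i) = (\<Sum>i<k. f i) + (\<Sum>i=k..N. f i)" for f :: "nat \<Rightarrow> nat"
    using N(1) sum.atLeastLessThan_concat[of 0 k "Suc N" f]
    by (simp add: atLeast0LessThan atLeastLessThanSuc_atLeastAtMost atLeast0AtMost
        lessThan_Suc_atMost del: sum.lessThan_Suc)
  have size: "csize \<delta> = (\<Sum>i<k. lookup \<delta> i) + (\<Sum>i=k..N. lookup \<delta> i)" "lookup \<delta> N = 0"
    "lookup \<delta> (Suc N) = 0"
    if "\<delta> \<in> compositions_upto N" for \<delta>
    using csize_upto[of \<delta> "Suc N"] that compositions_upto_mono[of N "Suc N"]
    by (auto simp del: sum.lessThan_Suc simp: split compositions_upto_def)
  \<comment> \<open>Row N is empty in all partitions involved, so nothing is left at the end of the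
    telescoping sum.\<close>
  have "lower N = 0"
    using size[OF N(2)] size[OF upto(1)] by (simp add: lower_def)
  have "(\<Sum>i=k..N. lookup \<beta> i) + (\<Sum>i=k..N. lookup ?t i) = (\<Sum>i=k..N. lower i + upper i)"
    unfolding sum.distrib[symmetric]
  proof (rule sum.cong)
    fix i assume "i \<in> {k..N}"
    then show "lookup \<beta> i + lookup ?t i = lower i + upper i"
      using between[of i] by (simp add: lookup_toggle)
  qed simp
  also have "\<dots> = b + (\<Sum>i=k..<N. lookup \<alpha> i + lookup \<gamma> (Suc i))"
    using N(1) \<open>lower N = 0\<close> by (simp add: sum_lower_upper)
  also have "\<dots> = b + (\<Sum>i=k..N. lookup \<alpha> i) + (\<Sum>i=Suc k..N. lookup \<gamma> i)"
    using N(1) size(2)[OF upto(1)] sum.shift_bounds_Suc_ivl[of "lookup \<gamma>" k N] size(2)[OF N(2)]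
    by (simp add: sum.distrib atLeastLessThanSuc_atLeastAtMost sum.last_plus)
  finally have *: "(\<Sum>i=k..N. lookup \<beta> i) + (\<Sum>i=k..N. lookup ?t i) =
    b + (\<Sum>i=k..N. lookup \<alpha> i) + (\<Sum>i=Suc k..N. lookup \<gamma> i)" .
  have "(\<Sum>i<k. lookup ?t i) = (\<Sum>i<k. lookup \<beta> i)"
    by (simp add: lookup_toggle)
  moreover have "(\<Sum>i=k..N. lookup \<gamma> i) = lookup \<gamma> k + (\<Sum>i=Suc k..N. lookup \<gamma> i)"
    using N(1) by (simp add: sum.atLeast_Suc_atMost)
  moreover have "(\<Sum>i\<le>k. lookup \<gamma> i) = (\<Sum>i<k. lookup \<gamma> i) + lookup \<gamma> k"
    by (simp add: lessThan_Suc_atMost[symmetric])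
  ultimately show ?thesis
    using * size(1)[OF upto(1)] size(1)[OF upto(2)] size(1)[OF upto(3)] size(1)[OF N(2)] by linarith
qed

end

section \<open>Weights of tableaux and their symmetry\<close>

text \<open>Meaningful if the sizes are eventually constant, as they are for tableaux;
  \<open>csize_tableau_Suc\<close> then replaces the truncated difference by an addition.\<close>

definition weight :: "(nat \<Rightarrow> composition) \<Rightarrow> composition" where
  "weight T = Abs_poly_mapping (\<lambda>j. csize (T (Suc j)) - csize (T j))"

lemma tableauD:
  assumes "semistandard_tableau lam \<kappa> T"
  shows "T 0 = \<kappa>" "T i \<leftharpoondown> T (Suc i)" "T i \<in> partitions"
  using assms by (auto simp: semistandard_tableau_def)

lemma tableau_eventually:
  assumes "semistandard_tableau lam \<kappa> T"
  obtains n where "\<And>N. N \<ge> n \<Longrightarrow> T N = lam"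
  using assms by (auto simp: semistandard_tableau_def)

lemma tableau_mono:
  assumes "semistandard_tableau lam \<kappa> T" "i \<le> j"
  shows "lookup (T i) r \<le> lookup (T j) r"
  by (rule lift_Suc_mono_le[OF _ assms(2), of "\<lambda>i. lookup (T i) r"])
    (rule interlacesD(4)[OF tableauD(2)[OF assms(1)]])

lemma tableau_le:
  assumes "semistandard_tableau lam \<kappa> T"
  shows "lookup (T i) r \<le> lookup lam r"
proof -
  obtain n where n: "\<And>N. N \<ge> n \<Longrightarrow> T N = lam"
    using assms by (rule tableau_eventually) blast
  have "lookup (T i) r \<le> lookup (T (max n i)) r"
    by (rule tableau_mono[OF assms]) simp
  then show ?thesis by (simp add: n)
qed

lemma csize_tableau_Suc:
  assumes T: "semistandard_tableau lam \<kappa> T"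
  shows "csize (T (Suc j)) = csize (T j) + lookup (weight T) j"
proof -
  obtain n where n: "\<And>N. N \<ge> n \<Longrightarrow> T N = lam"
    using assms by (rule tableau_eventually) blast
  have "j < n" if "csize (T (Suc j)) - csize (T j) \<noteq> 0" for j
    using that n[of j] n[of "Suc j"] by (cases "j < n") auto
  then have "{j. csize (T (Suc j)) - csize (T j) \<noteq> 0} \<subseteq> {..<n}" by auto
  then have "finite {j. csize (T (Suc j)) - csize (T j) \<noteq> 0}"
    by (rule finite_subset) simp
  then have "lookup (weight T) j = csize (T (Suc j)) - csize (T j)"
    by (simp add: weight_def)
  moreover have "csize (T j) \<le> csize (T (Suc j))"
    using tableau_mono[OF T] by (intro csize_mono) simp
  ultimately show ?thesis by simp
qed

lemma csize_tableau:
  assumes "semistandard_tableau lam \<kappa> T"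
  shows "csize (T n) = csize \<kappa> + (\<Sum>j<n. lookup (weight T) j)"
  by (induction n) (simp_all add: tableauD(1)[OF assms] csize_tableau_Suc[OF assms])

lemma csize_weight:
  assumes T: "semistandard_tableau lam \<kappa> T"
  shows "csize \<kappa> + csize (weight T) = csize lam"
proof -
  obtain n where n: "\<And>N. N \<ge> n \<Longrightarrow> T N = lam"
    using assms by (rule tableau_eventually) blast
  obtain m where m: "weight T \<in> compositions_upto m" by (rule composition_bound)
  then have "weight T \<in> compositions_upto (max m n)"
    using compositions_upto_mono[of m "max m n"] by auto
  then show ?thesis
    using csize_tableau[OF T, of "max m n"] n[of "max m n"] by (simp add: csize_upto)
qed

text \<open>Once the sizes stop growing, so do the nested partitions. Setting all but n variables to
  0 therefore selects the tableaux that are complete at stage n.\<close>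

lemma weight_upto_iff:
  assumes T: "semistandard_tableau lam \<kappa> T"
  shows "weight T \<in> compositions_upto n \<longleftrightarrow> (\<forall>N\<ge>n. T N = lam)"
proof
  assume w: "weight T \<in> compositions_upto n"
  have Suc: "T (Suc N) = T N" if "N \<ge> n" for N
  proof (rule csize_eq_imp_eq[symmetric])
    show "csize (T N) = csize (T (Suc N))"
      using w that csize_tableau_Suc[OF T, of N] by (simp add: compositions_upto_def)
  qed (rule tableau_mono[OF T], simp)
  have const: "T N = T n" if "N \<ge> n" for N
    using that by (induction N rule: dec_induct) (simp_all add: Suc)
  obtain m where m: "\<And>N. N \<ge> m \<Longrightarrow> T N = lam"
    using assms by (rule tableau_eventually) blast
  have "T n = lam"
    using const[of "max m n", symmetric] m[of "max m n"] by simp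
  with const show "\<forall>N\<ge>n. T N = lam" by metis
next
  assume "\<forall>N\<ge>n. T N = lam"
  then have "lookup (weight T) N = 0" if "N \<ge> n" for N
    using csize_tableau_Suc[OF T, of N] that by simp
  then show "weight T \<in> compositions_upto n"
    by (simp add: compositions_upto_def)
qed

lemma finite_tableaux_upto:
  "finite {T. semistandard_tableau lam \<kappa> T \<and> weight T \<in> compositions_upto n}"
proof -
  let ?B = "{a :: composition. Poly_Mapping.keys a \<subseteq> Poly_Mapping.keys lam \<and>
             (\<forall>i. lookup a i \<le> csize lam)}"
  have "finite {T. \<forall>x. (x \<in> {..<n} \<longrightarrow> T x \<in> ?B) \<and> (x \<notin> {..<n} \<longrightarrow> T x = lam)}"
    by (rule finite_set_of_finite_funs[OF _ finite_bounded_compositions]) simp_all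
  moreover have "T x \<in> ?B" if T: "semistandard_tableau lam \<kappa> T" for T x
    using tableau_le[OF T, of x] lookup_le_csize[of lam] le_trans
    unfolding mem_Collect_eq subset_iff in_keys_iff by (metis le_zero_eq)
  then have "{T. semistandard_tableau lam \<kappa> T \<and> weight T \<in> compositions_upto n} \<subseteq>
      {T. \<forall>x. (x \<in> {..<n} \<longrightarrow> T x \<in> ?B) \<and> (x \<notin> {..<n} \<longrightarrow> T x = lam)}"
    by (auto simp: weight_upto_iff not_less)
  ultimately show ?thesis by (rule finite_subset[rotated])
qed

lemma finite_tableaux_weight: "finite {T. semistandard_tableau lam \<kappa> T \<and> weight T = m}"
proof -
  obtain n where "m \<in> compositions_upto n" by (rule composition_bound)
  then show ?thesis
    by (intro finite_subset[OF _ finite_tableaux_upto[of lam \<kappa> n]]) auto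
qed

lemma tableau_update:
  assumes T: "semistandard_tableau lam \<kappa> T" and \<beta>: "T j \<leftharpoondown> \<beta>" "\<beta> \<leftharpoondown> T (Suc (Suc j))"
  shows "semistandard_tableau lam \<kappa> (T(Suc j := \<beta>))"
proof -
  obtain n where n: "\<And>N. N \<ge> n \<Longrightarrow> T N = lam"
    using assms(1) by (rule tableau_eventually) blast
  have "(T(Suc j := \<beta>)) N = lam" if "N \<ge> max n (Suc (Suc j))" for N
    using n[of N] that by auto
  then have "\<exists>N\<^sub>0. \<forall>N\<ge>N\<^sub>0. (T(Suc j := \<beta>)) N = lam" by blast
  moreover have "(\<forall>i. (T(Suc j := \<beta>)) i \<in> partitions) \<and> (T(Suc j := \<beta>)) 0 = \<kappa> \<and>
      (\<forall>i. (T(Suc j := \<beta>)) i \<leftharpoondown> (T(Suc j := \<beta>)) (Suc i))"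
    using tableauD[OF T] \<beta> interlacesD(1)[OF \<beta>(2)] by auto
  ultimately show ?thesis
    unfolding semistandard_tableau_def by blast
qed

lemma weight_update:
  assumes T: "semistandard_tableau lam \<kappa> T" and T': "semistandard_tableau lam \<kappa> (T(Suc j := \<beta>))"
  shows "csize \<beta> = csize (T j) + lookup (weight (T(Suc j := \<beta>))) j"
    and "csize (T (Suc (Suc j))) = csize \<beta> + lookup (weight (T(Suc j := \<beta>))) (Suc j)"
    and "i \<noteq> j \<Longrightarrow> i \<noteq> Suc j \<Longrightarrow> lookup (weight (T(Suc j := \<beta>))) i = lookup (weight T) i"
proof -
  show "csize \<beta> = csize (T j) + lookup (weight (T(Suc j := \<beta>))) j"
    using csize_tableau_Suc[OF T', of j] by simp
  show "csize (T (Suc (Suc j))) = csize \<beta> + lookup (weight (T(Suc j := \<beta>))) (Suc j)"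
    using csize_tableau_Suc[OF T', of "Suc j"] by simp
  show "lookup (weight (T(Suc j := \<beta>))) i = lookup (weight T) i" if "i \<noteq> j" "i \<noteq> Suc j"
    using csize_tableau_Suc[OF T', of i] csize_tableau_Suc[OF T, of i] that by simp
qed

text \<open>With k = 0 and b the first part of T(j+2) nothing is cut off: row 0 is bounded by the
  outer partition alone.\<close>

definition bender_knuth :: "nat \<Rightarrow> (nat \<Rightarrow> composition) \<Rightarrow> nat \<Rightarrow> composition" where
  "bender_knuth j T =
     T(Suc j := toggle (T j) (T (Suc (Suc j))) 0 (lookup (T (Suc (Suc j))) 0) (T (Suc j)))"

lemma lookup_map_key_transpose:
  "lookup (Poly_Mapping.map_key (Transposition.transpose i j) m) x =
     lookup m (Transposition.transpose i j x)"
  by (simp add: map_key.rep_eq)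

lemma bender_knuth:
  assumes T: "semistandard_tableau lam \<kappa> T"
  shows "semistandard_tableau lam \<kappa> (bender_knuth j T)"
    and "weight (bender_knuth j T) = Poly_Mapping.map_key (Transposition.transpose j (Suc j)) (weight T)"
    and "bender_knuth j (bender_knuth j T) = T"
proof -
  interpret toggling "T j" "T (Suc j)" "T (Suc (Suc j))" 0 "lookup (T (Suc (Suc j))) 0"
    using tableauD(2)[OF T] interlacesD(4)[OF tableauD(2)[OF T]] by unfold_locales simp_all
  show bk: "semistandard_tableau lam \<kappa> (bender_knuth j T)"
    unfolding bender_knuth_def using T toggle_interlaces by (rule tableau_update)
  note w = weight_update[OF T bk[unfolded bender_knuth_def], folded bender_knuth_def]
  show "weight (bender_knuth j T) = Poly_Mapping.map_key (Transposition.transpose j (Suc j)) (weight T)"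
  proof (rule poly_mapping_eqI)
    fix i
    show "lookup (weight (bender_knuth j T)) i =
        lookup (Poly_Mapping.map_key (Transposition.transpose j (Suc j)) (weight T)) i"
      using w csize_toggle csize_tableau_Suc[OF T, of j] csize_tableau_Suc[OF T, of "Suc j"]
      by (cases "i = j \<or> i = Suc j") (auto simp: lookup_map_key_transpose)
  qed
  show "bender_knuth j (bender_knuth j T) = T"
    using toggle_toggle by (simp add: bender_knuth_def)
qed

lemma card_tableaux_transpose_Suc:
  "card {T. semistandard_tableau lam \<kappa> T \<and>
       weight T = Poly_Mapping.map_key (Transposition.transpose j (Suc j)) m} =
   card {T. semistandard_tableau lam \<kappa> T \<and> weight T = m}"
proof -
  have inv: "Poly_Mapping.map_key (Transposition.transpose j (Suc j))
      (Poly_Mapping.map_key (Transposition.transpose j (Suc j)) m) = m" for m :: composition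
    by (intro poly_mapping_eqI) (simp add: lookup_map_key_transpose)
  show ?thesis
    by (rule bij_betw_same_card[of "bender_knuth j"],
        rule bij_betw_byWitness[of _ "bender_knuth j"])
      (auto simp: bender_knuth inv)
qed

section \<open>From adjacent transpositions to arbitrary bijections\<close>

definition stabilizer :: "(composition \<Rightarrow> 'a) \<Rightarrow> (nat \<Rightarrow> nat) set" where
  "stabilizer f = {\<pi>. bij \<pi> \<and> (\<forall>m. f (Poly_Mapping.map_key \<pi> m) = f m)}"

lemma stabilizer_comp:
  assumes "\<pi> \<in> stabilizer f" "\<rho> \<in> stabilizer f"
  shows "\<pi> \<circ> \<rho> \<in> stabilizer f"
  using assms unfolding stabilizer_def mem_Collect_eq
  by (metis bij_comp bij_is_inj map_key_compose)

lemma id_in_stabilizer: "id \<in> stabilizer f"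
  using bij_id by (simp add: stabilizer_def id_def map_key_id)

text \<open>The transposition of i and j + 1 is that of i and j, conjugated by the adjacent one of j
  and j + 1.\<close>

lemma transpose_in_stabilizer:
  assumes "\<And>j. Transposition.transpose j (Suc j) \<in> stabilizer f"
  shows "Transposition.transpose i j \<in> stabilizer f"
proof -
  have *: "Transposition.transpose i j \<in> stabilizer f" if "i < j" for i j
    using that
  proof (induction j)
    case (Suc j)
    show ?case
    proof (cases "i = j")
      case False
      then have "i < j" using Suc.prems by simp
      then have "Transposition.transpose i (Suc j) =
          Transposition.transpose j (Suc j) \<circ> Transposition.transpose i j \<circ> Transposition.transpose j (Suc j)"
        by (auto simp: fun_eq_iff Transposition.transpose_def)
      moreover have "Transposition.transpose i j \<in> stabilizer f"
        using Suc.IH \<open>i < j\<close> by simp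
      ultimately show ?thesis by (simp only: stabilizer_comp assms)
    qed (simp add: assms)
  qed simp
  show ?thesis
    using id_in_stabilizer[of f] *[of i j] *[of j i] by (cases i j rule: linorder_cases) (auto simp: transpose_commute)
qed

text \<open>On the finite support of a composition, every bijection agrees with a product of
  transpositions.\<close>

lemma stabilizer_eq_bij:
  assumes "\<And>j. Transposition.transpose j (Suc j) \<in> stabilizer f"
  shows "stabilizer f = {\<pi>. bij \<pi>}"
proof -
  have ex: "\<exists>\<rho>\<in>stabilizer f. \<forall>a\<in>A. \<rho> a = \<pi> a" if "bij \<pi>" "finite A" for \<pi> A
    using that(2)
  proof (induction A)
    case (insert x A)
    then obtain \<rho> where \<rho>: "\<rho> \<in> stabilizer f" "\<And>a. a \<in> A \<Longrightarrow> \<rho> a = \<pi> a" by blast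
    \<comment> \<open>The correction \<open>?t\<close> sends \<rho> x to \<pi> x and leaves the
      images of A alone, since they differ from both.\<close>
    let ?t = "Transposition.transpose (\<rho> x) (\<pi> x)"
    have "(?t \<circ> \<rho>) a = \<pi> a" if "a \<in> insert x A" for a
    proof (cases "a = x")
      case False
      then have "a \<in> A" using that by simp
      moreover have "\<pi> a \<noteq> \<pi> x" "\<rho> a \<noteq> \<rho> x"
        using False \<open>bij \<pi>\<close> \<rho>(1) by (auto simp: stabilizer_def bij_def inj_eq)
      ultimately show ?thesis using \<rho>(2)[of a] by simp
    qed simp
    then show ?case
      using stabilizer_comp[OF transpose_in_stabilizer[OF assms, of "\<rho> x" "\<pi> x"] \<rho>(1)] by blast
  qed (use id_in_stabilizer in blast)
  have "f (Poly_Mapping.map_key \<pi> m) = f m" if \<pi>: "bij \<pi>" for \<pi> m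
  proof -
    let ?A = "\<pi> -` Poly_Mapping.keys m"
    have "finite ?A" using \<pi> by (intro finite_vimageI) (auto simp: bij_def)
    from ex[OF \<pi> this] obtain \<rho>
      where \<rho>: "\<rho> \<in> stabilizer f" "\<And>a. a \<in> ?A \<Longrightarrow> \<rho> a = \<pi> a" by blast
    have \<rho>_bij: "bij \<rho>" using \<rho>(1) by (simp add: stabilizer_def)
    \<comment> \<open>Agreement on \<open>?A\<close> is enough: by injectivity, \<rho> cannot send
      an index outside \<open>?A\<close> into the support of m.\<close>
    have "lookup m (\<pi> i) = lookup m (\<rho> i)" for i
    proof (cases "\<rho> i \<in> Poly_Mapping.keys m")
      case True
      then obtain a where a: "\<pi> a = \<rho> i" by (metis \<pi> bij_pointE)
      with True have "\<rho> a = \<rho> i" using \<rho>(2)[of a] by simp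
      then have "a = i" using \<rho>_bij by (simp add: bij_def inj_eq)
      with a show ?thesis by simp
    next
      case False
      then have "i \<notin> ?A" using \<rho>(2)[of i] by auto
      with False show ?thesis by (simp add: in_keys_iff)
    qed
    then have "Poly_Mapping.map_key \<pi> m = Poly_Mapping.map_key \<rho> m"
      using \<pi> \<rho>_bij by (intro poly_mapping_eqI) (simp add: map_key.rep_eq bij_is_inj)
    then show ?thesis using \<rho>(1) by (simp add: stabilizer_def)
  qed
  then show ?thesis by (auto simp: stabilizer_def)
qed

lift_definition tableau_series :: "composition \<Rightarrow> composition \<Rightarrow> symfun" is
  "\<lambda>lam \<kappa> m. int (card {T. semistandard_tableau lam \<kappa> T \<and> weight T = m})"
proof (intro conjI allI impI)
  fix lam \<kappa> :: composition
  let ?f = "\<lambda>m. int (card {T. semistandard_tableau lam \<kappa> T \<and> weight T = m})"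
  have "stabilizer ?f = {\<pi>. bij \<pi>}"
    by (rule stabilizer_eq_bij) (simp add: stabilizer_def card_tableaux_transpose_Suc)
  then show "?f (Poly_Mapping.map_key \<pi> m) = ?f m" if "bij \<pi>" for \<pi> m
    using that by (auto simp: stabilizer_def)
  have "csize m \<le> csize lam" if "?f m \<noteq> 0" for m
  proof -
    have "{T. semistandard_tableau lam \<kappa> T \<and> weight T = m} \<noteq> {}"
      using that by (metis card.empty of_nat_0)
    then obtain T where "semistandard_tableau lam \<kappa> T" "weight T = m" by blast
    then show ?thesis using csize_weight by fastforce
  qed
  then show "\<exists>d. \<forall>m. ?f m \<noteq> 0 \<longrightarrow> csize m \<le> d" by blast
qed

section \<open>Alternants and truncations\<close>

text \<open>Brings the product of polynomials into the form that defines
  \<open>times_symfun\<close>, so that the two can be compared under truncation.\<close>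

lemma lookup_times_composition:
  fixes p q :: zpoly
  shows "lookup (p * q) m = (\<Sum>(a, b) | a + b = m. lookup p a * lookup q b)"
proof -
  have "lookup (p * q) m = (\<Sum>(a, b). lookup p a * lookup q b when m = a + b)"
    by (simp add: times_poly_mapping.rep_eq prod_fun_unfold_prod)
  also have "\<dots> = (\<Sum>(a, b) | a + b = m. lookup p a * lookup q b when m = a + b)"
    by (rule Sum_any.expand_superset) (auto simp: finite_decompositions)
  also have "\<dots> = (\<Sum>(a, b) | a + b = m. lookup p a * lookup q b)"
    by (intro sum.cong) auto
  finally show ?thesis .
qed

lemma lookup_truncate_vars:
  "lookup (truncate_vars n f) m = (if m \<in> compositions_upto n then sf_coeff f m else 0)"
  by (simp add: truncate_vars.rep_eq)

text \<open>A sum of exponent vectors involves only the first n variables exactly when both summands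
  do.\<close>

lemma truncate_vars_mult: "truncate_vars n (f * g) = truncate_vars n f * truncate_vars n g"
proof (rule poly_mapping_eqI)
  fix m
  show "lookup (truncate_vars n (f * g)) m = lookup (truncate_vars n f * truncate_vars n g) m"
    unfolding lookup_times_composition lookup_truncate_vars times_symfun.rep_eq
    by (cases "m \<in> compositions_upto n") (auto intro!: sum.cong sum.neutral)
qed

lemma truncate_vars_add: "truncate_vars n (f + g) = truncate_vars n f + truncate_vars n g"
  by (rule poly_mapping_eqI) (simp add: lookup_truncate_vars lookup_add plus_symfun.rep_eq)

lemma truncate_vars_eqD:
  assumes "\<And>n. truncate_vars n f = truncate_vars n g"
  shows "f = g"
proof (rule symfun_eqI)
  fix m
  obtain n where "m \<in> compositions_upto n" by (rule composition_bound)
  then show "sf_coeff f m = sf_coeff g m"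
    using arg_cong[OF assms[of n], of "\<lambda>p. lookup p m"] by (simp add: lookup_truncate_vars)
qed

lemma indet_power: "indet i ^ k = Poly_Mapping.single (Poly_Mapping.single i k) 1"
  by (induction k) (simp_all add: indet_def mult_single single_add[symmetric])

lemma prod_indet_power:
  "(\<Prod>i<n::nat. indet (\<sigma> i) ^ k i) =
     Poly_Mapping.single (\<Sum>i<n. Poly_Mapping.single (\<sigma> i) (k i)) 1"
  by (induction n) (simp_all add: indet_power mult_single add.commute)

lemma map_key_permutes_upto:
  assumes "\<sigma> permutes {..<n}"
  shows "Poly_Mapping.map_key \<sigma> \<alpha> \<in> compositions_upto n \<longleftrightarrow> \<alpha> \<in> compositions_upto n"
  using permutes_not_in[OF assms]
  by (auto simp: compositions_upto_def map_key.rep_eq permutes_inj[OF assms])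

lemma prod_indet_permutes:
  assumes \<sigma>: "\<sigma> permutes {..<n}" and \<alpha>: "\<alpha> \<in> compositions_upto n"
  shows "(\<Prod>i<n. indet (inv \<sigma> i) ^ lookup \<alpha> i) = Poly_Mapping.single (Poly_Mapping.map_key \<sigma> \<alpha>) 1"
proof -
  have "(\<Sum>i<n. Poly_Mapping.single (inv \<sigma> i) (lookup \<alpha> i)) = Poly_Mapping.map_key \<sigma> \<alpha>"
  proof (rule poly_mapping_eqI)
    fix x
    have "inv \<sigma> i = x \<longleftrightarrow> i = \<sigma> x" for i
      using permutes_inverses[OF \<sigma>] by auto
    then have "lookup (\<Sum>i<n. Poly_Mapping.single (inv \<sigma> i) (lookup \<alpha> i)) x =
        (\<Sum>i<n. if i = \<sigma> x then lookup \<alpha> i else 0)"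
      by (simp add: lookup_sum lookup_single when_def)
    also have "\<dots> = lookup \<alpha> (\<sigma> x)"
      using \<alpha> by (simp add: sum.delta compositions_upto_def)
    finally show "lookup (\<Sum>i<n. Poly_Mapping.single (inv \<sigma> i) (lookup \<alpha> i)) x =
        lookup (Poly_Mapping.map_key \<sigma> \<alpha>) x"
      by (simp add: map_key.rep_eq permutes_inj[OF \<sigma>])
  qed
  then show ?thesis by (simp add: prod_indet_power)
qed

lemma of_int_mult_single:
  "of_int c * Poly_Mapping.single m d = (Poly_Mapping.single m (c * d) :: zpoly)"
  by (metis add_0 id_apply mult_single of_int_eq_id single_of_int)

text \<open>Summation over inverse permutations makes \<open>map_key \<sigma> \<alpha>\<close> the
  exponent vector of each term, so that permuting exponents becomes composition of
  permutations.\<close>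

lemma alternant_eq:
  assumes "\<alpha> \<in> compositions_upto n"
  shows "alternant n \<alpha> =
    (\<Sum>\<sigma> | \<sigma> permutes {..<n}. Poly_Mapping.single (Poly_Mapping.map_key \<sigma> \<alpha>) (sign \<sigma>))"
proof -
  have "of_int (sign (inv \<sigma>)) * (\<Prod>i<n. indet (inv \<sigma> i) ^ lookup \<alpha> i) =
      Poly_Mapping.single (Poly_Mapping.map_key \<sigma> \<alpha>) (sign \<sigma>)" if \<sigma>: "\<sigma> permutes {..<n}" for \<sigma>
  proof -
    have "sign (inv \<sigma>) = sign \<sigma>"
      using \<sigma> by (intro sign_inverse permutes_imp_permutation[of "{..<n}"]) simp_all
    then show ?thesis
      using prod_indet_permutes[OF \<sigma> assms] by (simp add: of_int_mult_single)
  qed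
  then show ?thesis
    unfolding alternant_def by (subst sum_permutations_inverse) (auto intro!: sum.cong)
qed

lemma alternant_transpose:
  assumes "\<alpha> \<in> compositions_upto n" "Suc j < n"
  shows "alternant n (Poly_Mapping.map_key (Transposition.transpose j (Suc j)) \<alpha>) = - alternant n \<alpha>"
proof -
  let ?t = "Transposition.transpose j (Suc j)"
  have t: "?t permutes {..<n}" using assms(2) by (intro permutes_swap_id) auto
  have "Poly_Mapping.single (Poly_Mapping.map_key \<sigma> (Poly_Mapping.map_key ?t \<alpha>)) (sign \<sigma>) =
      - Poly_Mapping.single (Poly_Mapping.map_key (?t \<circ> \<sigma>) \<alpha>) (sign (?t \<circ> \<sigma>))"
    if \<sigma>: "\<sigma> permutes {..<n}" for \<sigma>
  proof -
    have "sign (?t \<circ> \<sigma>) = - sign \<sigma>"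
      using \<sigma> by (subst sign_compose)
        (auto simp: permutation_swap_id sign_swap_id intro: permutes_imp_permutation[of "{..<n}"])
    then show ?thesis
      using permutes_inj[OF \<sigma>] by (simp only: map_key_compose inj_transpose single_uminus minus_minus)
  qed
  then have "alternant n (Poly_Mapping.map_key ?t \<alpha>) =
      - (\<Sum>\<sigma> | \<sigma> permutes {..<n}. Poly_Mapping.single (Poly_Mapping.map_key (?t \<circ> \<sigma>) \<alpha>) (sign (?t \<circ> \<sigma>)))"
    using assms(1) t
    by (auto simp: alternant_eq map_key_permutes_upto sum_negf[symmetric] intro!: sum.cong)
  also have "\<dots> = - alternant n \<alpha>"
    unfolding alternant_eq[OF assms(1)]
    by (subst setum_permutations_compose_left[OF t, symmetric]) simp
  finally show ?thesis .
qed

text \<open>Symmetry in the form that fits alternants: for each term \<sigma> of the alternant, the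
  other factor is rewritten with its monomials permuted by \<sigma>.\<close>

lemma truncate_vars_eq_sum:
  assumes \<sigma>: "\<sigma> permutes {..<n}"
  shows "truncate_vars n f = (\<Sum>m\<in>Poly_Mapping.keys (truncate_vars n f).
      Poly_Mapping.single (Poly_Mapping.map_key \<sigma> m) (sf_coeff f m))"
proof (rule poly_mapping_eqI)
  fix x :: composition
  let ?K = "Poly_Mapping.keys (truncate_vars n f)"
  let ?y = "Poly_Mapping.map_key (inv \<sigma>) x"
  have bij: "bij \<sigma>" using \<sigma> by (rule permutes_bij)
  have f: "sf_coeff f ?y = sf_coeff f x"
    using sf_coeff[of f] bij_imp_bij_inv[OF bij] by simp
  have y: "?y \<in> compositions_upto n \<longleftrightarrow> x \<in> compositions_upto n"
    by (rule map_key_permutes_upto[OF permutes_inv[OF \<sigma>]])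
  have "Poly_Mapping.map_key \<sigma> m = x \<longleftrightarrow> m = ?y" for m
    using map_key_bij_inv[OF bij] by metis
  then have "lookup (\<Sum>m\<in>?K. Poly_Mapping.single (Poly_Mapping.map_key \<sigma> m) (sf_coeff f m)) x =
      (\<Sum>m\<in>?K. if m = ?y then sf_coeff f m else 0)"
    by (simp add: lookup_sum lookup_single when_def)
  also have "\<dots> = (if ?y \<in> ?K then sf_coeff f ?y else 0)"
    by (rule sum.delta) simp
  also have "\<dots> = lookup (truncate_vars n f) x"
    using f y by (auto simp: in_keys_iff lookup_truncate_vars)
  finally show "lookup (truncate_vars n f) x =
    lookup (\<Sum>m\<in>?K. Poly_Mapping.single (Poly_Mapping.map_key \<sigma> m) (sf_coeff f m)) x" by simp
qed

text \<open>With the monomials of the factor permuted along with each term, exponents add under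
  \<open>map_key \<sigma>\<close>, and exchanging the sums collects alternants again.\<close>

lemma alternant_mult_truncate_vars:
  assumes \<beta>: "\<beta> \<in> compositions_upto n"
  shows "alternant n \<beta> * truncate_vars n f =
    (\<Sum>m\<in>Poly_Mapping.keys (truncate_vars n f). of_int (sf_coeff f m) * alternant n (\<beta> + m))"
proof -
  let ?K = "Poly_Mapping.keys (truncate_vars n f)"
  have K: "m \<in> compositions_upto n" if "m \<in> ?K" for m
    using that by (auto simp: in_keys_iff lookup_truncate_vars split: if_splits)
  have "alternant n \<beta> * truncate_vars n f = (\<Sum>\<sigma> | \<sigma> permutes {..<n}.
      Poly_Mapping.single (Poly_Mapping.map_key \<sigma> \<beta>) (sign \<sigma>) * truncate_vars n f)"
    unfolding alternant_eq[OF \<beta>] by (rule sum_distrib_right)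
  also have "\<dots> = (\<Sum>\<sigma> | \<sigma> permutes {..<n}. \<Sum>m\<in>?K. of_int (sf_coeff f m) *
      Poly_Mapping.single (Poly_Mapping.map_key \<sigma> (\<beta> + m)) (sign \<sigma>))"
  proof (rule sum.cong)
    fix \<sigma> assume "\<sigma> \<in> {\<sigma>. \<sigma> permutes {..<n}}"
    then have \<sigma>: "\<sigma> permutes {..<n}" by simp
    have "Poly_Mapping.single (Poly_Mapping.map_key \<sigma> \<beta>) (sign \<sigma>) *
        Poly_Mapping.single (Poly_Mapping.map_key \<sigma> m) (sf_coeff f m) =
      of_int (sf_coeff f m) * Poly_Mapping.single (Poly_Mapping.map_key \<sigma> (\<beta> + m)) (sign \<sigma>)" for m
      by (simp add: mult_single of_int_mult_single map_key_plus[OF permutes_inj[OF \<sigma>]] mult.commute)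
    then show "Poly_Mapping.single (Poly_Mapping.map_key \<sigma> \<beta>) (sign \<sigma>) * truncate_vars n f =
      (\<Sum>m\<in>?K. of_int (sf_coeff f m) *
        Poly_Mapping.single (Poly_Mapping.map_key \<sigma> (\<beta> + m)) (sign \<sigma>))"
      by (subst truncate_vars_eq_sum[OF \<sigma>]) (simp add: sum_distrib_left)
  qed simp
  also have "\<dots> = (\<Sum>m\<in>?K. of_int (sf_coeff f m) * alternant n (\<beta> + m))"
    by (subst sum.swap) (simp add: alternant_eq K \<beta> sum_distrib_left)
  finally show ?thesis .
qed

lemma lookup_staircase: "lookup (staircase n) i = (if i < n then n - Suc i else 0)"
  by (simp add: staircase_def nth_default_def rev_nth)

lemma staircase_upto [simp]: "staircase n \<in> compositions_upto n"
  by (simp add: compositions_upto_def lookup_staircase)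

lemma staircase_add_strict:
  assumes "\<nu> \<in> partitions" "i < j" "j < n"
  shows "lookup (staircase n + \<nu>) j < lookup (staircase n + \<nu>) i"
  using partitions_antimono[OF assms(1), of i j] assms by (simp add: lookup_add lookup_staircase)

lemma permutes_strict_mono_eq_id:
  fixes \<sigma> :: "nat \<Rightarrow> nat"
  assumes "\<sigma> permutes {..<n}" "\<And>i j. i < j \<Longrightarrow> j < n \<Longrightarrow> \<sigma> i < \<sigma> j"
  shows "\<sigma> = id"
proof (rule permutes_natset_ge[OF assms(1)])
  have "i \<le> \<sigma> i" if "i < n" for i
    using that
  proof (induction i)
    case (Suc i)
    then show ?case using assms(2)[of i "Suc i"] by simp
  qed simp
  then show "\<forall>i\<in>{..<n}. i \<le> \<sigma> i" by simp
qed

text \<open>Both exponent vectors strictly decrease below n, and only the identity carries one such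
  vector to another. This coefficient therefore detects \<nu>.\<close>

lemma lookup_alternant_staircase:
  assumes \<nu>: "\<nu> \<in> partitions" "\<nu> \<in> compositions_upto n" and \<nu>': "\<nu>' \<in> partitions"
  shows "lookup (alternant n (staircase n + \<nu>)) (staircase n + \<nu>') = of_bool (\<nu> = \<nu>')"
proof -
  have iff: "Poly_Mapping.map_key \<sigma> (staircase n + \<nu>) = staircase n + \<nu>' \<longleftrightarrow> \<sigma> = id \<and> \<nu> = \<nu>'"
    if \<sigma>: "\<sigma> permutes {..<n}" for \<sigma>
  proof (safe)
    assume eq: "Poly_Mapping.map_key \<sigma> (staircase n + \<nu>) = staircase n + \<nu>'"
    have l: "lookup (staircase n + \<nu>') i = lookup (staircase n + \<nu>) (\<sigma> i)" for i
      unfolding eq[symmetric] by (simp add: map_key.rep_eq permutes_inj[OF \<sigma>])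
    show id: "\<sigma> = id"
    proof (rule permutes_strict_mono_eq_id[OF \<sigma>])
      fix i j assume ij: "i < j" "j < n"
      have "\<sigma> i < n" using permutes_in_image[OF \<sigma>, of i] ij by simp
      moreover have "\<not> lookup (staircase n + \<nu>) (\<sigma> i) \<le> lookup (staircase n + \<nu>) (\<sigma> j)"
        using staircase_add_strict[OF \<nu>' ij] unfolding l by simp
      ultimately show "\<sigma> i < \<sigma> j"
        using staircase_add_strict[OF \<nu>(1), of "\<sigma> j" "\<sigma> i" n]
        by (metis less_or_eq_imp_le linorder_less_linear order_refl)
    qed
    from eq show "\<nu> = \<nu>'" by (simp add: id map_key_id[folded id_def])
  next
    show "Poly_Mapping.map_key id (staircase n + \<nu>') = staircase n + \<nu>'"
      by (simp add: id_def map_key_id)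
  qed
  have "lookup (alternant n (staircase n + \<nu>)) (staircase n + \<nu>') =
      (\<Sum>\<sigma> | \<sigma> permutes {..<n}. if \<sigma> = id then of_bool (\<nu> = \<nu>') else 0)"
    using \<nu>(2) by (subst alternant_eq) (auto simp: lookup_sum lookup_single iff when_def intro!: sum.cong)
  also have "\<dots> = of_bool (\<nu> = \<nu>')"
    by (subst sum.delta) (auto simp: finite_permutations permutes_id)
  finally show ?thesis .
qed

lemma zero_in_partitions [simp]: "0 \<in> partitions"
  by (simp add: partitions_def)

lemma zero_in_upto [simp]: "0 \<in> compositions_upto n"
  by (simp add: compositions_upto_def)

lemma vandermonde_nonzero: "alternant n (staircase n) \<noteq> 0"
  using lookup_alternant_staircase[of 0 n 0] by auto

section \<open>The sign-reversing involution\<close>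

definition row_sum_upto :: "composition \<Rightarrow> nat \<Rightarrow> nat" where
  "row_sum_upto \<alpha> k = (\<Sum>i<k. lookup \<alpha> i)"

text \<open>The entry \<open>M\<^sub>i\<^sub>,\<^sub>j\<close> of the integral encoding is \<open>T\<^sub>j\<^sub>+\<^sub>1 - T\<^sub>j\<close> at \<open>i\<close>; with all subtractions moved to the
  other side, a violation at \<open>(k, j)\<close> is the failure of
  \<open>\<mu>\<^sub>j\<^sub>+\<^sub>1 + (\<Sum>i\<le>k. M\<^sub>i\<^sub>,\<^sub>j\<^sub>+\<^sub>1) \<le> \<mu>\<^sub>j + (\<Sum>i<k. M\<^sub>i\<^sub>,\<^sub>j)\<close>.\<close>

definition violation :: "composition \<Rightarrow> (nat \<Rightarrow> composition) \<Rightarrow> nat \<Rightarrow> nat \<Rightarrow> bool" where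
  "violation \<mu> T k j \<longleftrightarrow>
     lookup \<mu> j + row_sum_upto (T (Suc j)) k + row_sum_upto (T (Suc j)) (Suc k) <
     lookup \<mu> (Suc j) + row_sum_upto (T (Suc (Suc j))) (Suc k) + row_sum_upto (T j) k"

text \<open>The bound in row \<open>k\<close> cuts off the letters \<open>j + 1\<close> up to and including the one that causes the
  first violation; past it, the exponents \<open>j\<close> and \<open>j + 1\<close> of \<open>\<delta> + \<mu>\<close> plus the partial weight agree.\<close>

definition violation_bound :: "composition \<Rightarrow> (nat \<Rightarrow> composition) \<Rightarrow> nat \<Rightarrow> nat \<Rightarrow> nat" where
  "violation_bound \<mu> T k j =
     lookup \<mu> (Suc j) + row_sum_upto (T (Suc (Suc j))) (Suc k) + row_sum_upto (T j) k -
     (2 * row_sum_upto (T (Suc j)) k + lookup \<mu> j + 1)"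

definition violation_toggle ::
    "composition \<Rightarrow> nat \<Rightarrow> nat \<Rightarrow> (nat \<Rightarrow> composition) \<Rightarrow> nat \<Rightarrow> composition" where
  "violation_toggle \<mu> k j T =
     T(Suc j := toggle (T j) (T (Suc (Suc j))) k (violation_bound \<mu> T k j) (T (Suc j)))"

text \<open>Rows are read from top to bottom and each row from right to left, so that within row \<open>k\<close>
  the largest \<open>j\<close> is met first.\<close>

definition first_violation :: "composition \<Rightarrow> (nat \<Rightarrow> composition) \<Rightarrow> nat \<Rightarrow> nat \<Rightarrow> bool" where
  "first_violation \<mu> T k j \<longleftrightarrow> violation \<mu> T k j \<and>
     (\<forall>k'<k. \<forall>j'. \<not> violation \<mu> T k' j') \<and> (\<forall>j'>j. \<not> violation \<mu> T k j')"

lemma row_sum_upto_Suc: "row_sum_upto \<alpha> (Suc k) = row_sum_upto \<alpha> k + lookup \<alpha> k"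
  by (simp add: row_sum_upto_def)

lemma row_sum_upto_mono:
  assumes "\<And>i. lookup \<alpha> i \<le> lookup \<beta> i"
  shows "row_sum_upto \<alpha> k \<le> row_sum_upto \<beta> k"
  unfolding row_sum_upto_def by (intro sum_mono assms)

lemma first_violation_toggle:
  assumes T: "semistandard_tableau lam \<kappa> T" and \<mu>: "\<mu> \<in> partitions"
    and v: "first_violation \<mu> T k j"
  shows "semistandard_tableau lam \<kappa> (violation_toggle \<mu> k j T)"
    and "first_violation \<mu> (violation_toggle \<mu> k j T) k j"
    and "violation_toggle \<mu> k j (violation_toggle \<mu> k j T) = T"
    and "Suc j < n \<Longrightarrow> staircase n + (\<mu> + weight (violation_toggle \<mu> k j T)) =
      Poly_Mapping.map_key (Transposition.transpose j (Suc j)) (staircase n + (\<mu> + weight T))"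
proof -
  define b where "b = violation_bound \<mu> T k j"
  let ?\<alpha> = "T j" and ?\<beta> = "T (Suc j)" and ?\<gamma> = "T (Suc (Suc j))"
  have viol: "violation \<mu> T k j" and no: "\<And>k' j'. k' < k \<Longrightarrow> \<not> violation \<mu> T k' j'"
    and no': "\<And>j'. j' > j \<Longrightarrow> \<not> violation \<mu> T k j'"
    using v by (auto simp: first_violation_def)
  \<comment> \<open>The strict inequality of the violation makes up for the summand 1, so the
    truncated difference is exact.\<close>
  have b: "b + (2 * row_sum_upto ?\<beta> k + lookup \<mu> j + 1) =
      lookup \<mu> (Suc j) + row_sum_upto ?\<gamma> (Suc k) + row_sum_upto ?\<alpha> k"
    using viol by (simp add: b_def violation_bound_def violation_def row_sum_upto_Suc)
  \<comment> \<open>Since row k - 1 passed the test, b is less than \<gamma>_k + \<alpha>_(k-1) -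
    \<beta>_(k-1), and \<beta>_(k-1) is at least each of the other two entries. For k = 0, the
    monotonicity of \<mu> takes the place of the test.\<close>
  have *: "b \<le> lookup ?\<gamma> k \<and> (k > 0 \<longrightarrow> b \<le> lookup ?\<alpha> (k - 1))"
  proof (cases k)
    case 0
    then show ?thesis
      using b partitions_antimono[OF \<mu>, of j "Suc j"] by (simp add: row_sum_upto_def)
  next
    case (Suc k')
    have "\<not> violation \<mu> T k' j" using Suc by (intro no) simp
    then show ?thesis
      using b Suc interlacesD(3)[OF tableauD(2)[OF T], of "Suc j" k'] interlacesD(4)[OF tableauD(2)[OF T], of j k']
      by (simp add: violation_def row_sum_upto_Suc)
  qed
  interpret toggling ?\<alpha> ?\<beta> ?\<gamma> k b
  proof
    show "?\<alpha> \<leftharpoondown> ?\<beta>" "?\<beta> \<leftharpoondown> ?\<gamma>" using tableauD(2)[OF T] by auto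
    show "lookup ?\<beta> k \<le> b" using b viol by (simp add: violation_def row_sum_upto_Suc)
  qed (use * in auto)
  let ?T = "violation_toggle \<mu> k j T"
  have T'_eq: "?T = T(Suc j := toggle ?\<alpha> ?\<gamma> k b ?\<beta>)"
    by (simp add: violation_toggle_def b_def)
  \<comment> \<open>The tests at earlier places, and the bound itself, read the partition T(j+1) in
    rows i < k only.\<close>
  have same_rows: "row_sum_upto (?T j') k' = row_sum_upto (T j') k'" if "k' \<le> k \<or> j' \<noteq> Suc j" for k' j'
    using that by (auto simp: T'_eq row_sum_upto_def lookup_toggle intro!: sum.cong)
  show T': "semistandard_tableau lam \<kappa> ?T"
    unfolding T'_eq using T toggle_interlaces by (rule tableau_update)
  \<comment> \<open>An entry at most b in row k is exactly what makes the violation persist.\<close>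
  have "row_sum_upto (?T (Suc j)) k = row_sum_upto ?\<beta> k"
    by (rule same_rows) simp
  then have "violation \<mu> ?T k j"
    using b toggle_bound by (simp add: violation_def row_sum_upto_Suc T'_eq)
  then show "first_violation \<mu> ?T k j"
    using no no' unfolding first_violation_def violation_def by (auto simp: same_rows)
  have "violation_bound \<mu> ?T k j = b"
    unfolding b_def violation_bound_def by (simp add: same_rows)
  then show "violation_toggle \<mu> k j ?T = T"
    unfolding violation_toggle_def[of \<mu> k j ?T] using toggle_toggle by (simp add: T'_eq)
  assume n: "Suc j < n"
  note w = weight_update[OF T T'[unfolded T'_eq], folded T'_eq]
  \<comment> \<open>Inserting the equation for b replaces the row sums by \<mu> and a summand 1,
    which is the difference of the exponents j and j + 1 of \<delta>.\<close>
  have cs: "csize ?\<beta> + csize (toggle ?\<alpha> ?\<gamma> k b ?\<beta>) + row_sum_upto ?\<gamma> (Suc k) + row_sum_upto ?\<alpha> k =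
      2 * row_sum_upto ?\<beta> k + csize ?\<alpha> + csize ?\<gamma> + b"
    using csize_toggle by (simp add: row_sum_upto_def lessThan_Suc_atMost)
  show "staircase n + (\<mu> + weight ?T) =
      Poly_Mapping.map_key (Transposition.transpose j (Suc j)) (staircase n + (\<mu> + weight T))"
  proof (rule poly_mapping_eqI)
    fix i
    show "lookup (staircase n + (\<mu> + weight ?T)) i = lookup
        (Poly_Mapping.map_key (Transposition.transpose j (Suc j)) (staircase n + (\<mu> + weight T))) i"
    proof (cases "i = j \<or> i = Suc j")
      case True
      then show ?thesis
        using cs b w(1,2) n csize_tableau_Suc[OF T, of j] csize_tableau_Suc[OF T, of "Suc j"]
        by (auto simp: lookup_map_key_transpose lookup_add lookup_staircase)
    next
      case False
      then show ?thesis
        using w(3)[of i] by (simp add: lookup_map_key_transpose lookup_add)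
    qed
  qed
qed

text \<open>Letters from n on do not occur, so none of them can outnumber its predecessor. This
  keeps the exchanged exponents among the n variables and bounds j in the choice of the first
  violation.\<close>

lemma violation_index:
  assumes T: "semistandard_tableau lam \<kappa> T" and w: "weight T \<in> compositions_upto n"
    and \<mu>: "\<mu> \<in> compositions_upto n" and v: "violation \<mu> T k j"
  shows "Suc j < n"
proof (rule ccontr)
  assume "\<not> Suc j < n"
  then have "T (Suc j) = lam" "T (Suc (Suc j)) = lam" "lookup \<mu> (Suc j) = 0"
    using w \<mu> weight_upto_iff[OF T] by (auto simp: compositions_upto_def)
  moreover have "row_sum_upto (T j) k \<le> row_sum_upto lam k"
    using tableau_le[OF T] by (rule row_sum_upto_mono)
  ultimately show False using v by (simp add: violation_def)
qed

lemma first_violation_exists: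
  assumes T: "semistandard_tableau lam \<kappa> T" and w: "weight T \<in> compositions_upto n"
    and \<mu>: "\<mu> \<in> compositions_upto n" and v: "violation \<mu> T k j"
  obtains k' j' where "first_violation \<mu> T k' j'"
proof -
  define k' where "k' = (LEAST k. \<exists>j. violation \<mu> T k j)"
  have "\<exists>j. violation \<mu> T k' j"
    unfolding k'_def by (rule LeastI_ex) (use v in blast)
  then obtain j0 where j0: "violation \<mu> T k' j0" by blast
  define j' where "j' = (GREATEST j. violation \<mu> T k' j)"
  have bound: "j \<le> n" if "violation \<mu> T k' j" for j
    using violation_index[OF T w \<mu> that] by simp
  have "violation \<mu> T k' j'"
    unfolding j'_def using j0 bound by (rule GreatestI_nat)
  moreover have "j \<le> j'" if "violation \<mu> T k' j" for j
    unfolding j'_def using that bound by (rule Greatest_le_nat)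
  moreover have "\<not> violation \<mu> T k'' j" if "k'' < k'" for k'' j
    using not_less_Least[OF that[unfolded k'_def]] by blast
  ultimately have "first_violation \<mu> T k' j'"
    unfolding first_violation_def by (meson leD)
  then show thesis by (rule that)
qed

lemma first_violation_unique:
  assumes "first_violation \<mu> T k j" "first_violation \<mu> T k' j'"
  shows "k = k'" "j = j'"
  using assms unfolding first_violation_def by (metis linorder_neqE_nat)+

text \<open>The choice is unambiguous by \<open>first_violation_unique\<close>, and the toggled
  tableau has the same first violation; hence a second application leads back.\<close>

definition row_cancel :: "composition \<Rightarrow> (nat \<Rightarrow> composition) \<Rightarrow> nat \<Rightarrow> composition" where
  "row_cancel \<mu> T = (let (k, j) = SOME (k, j). first_violation \<mu> T k j in violation_toggle \<mu> k j T)"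

lemma row_cancel_eq:
  assumes "first_violation \<mu> T k j"
  shows "row_cancel \<mu> T = violation_toggle \<mu> k j T"
proof -
  have "(SOME (k, j). first_violation \<mu> T k j) = (k, j)"
  proof (rule some_equality)
    show "p = (k, j)" if "case p of (k, j) \<Rightarrow> first_violation \<mu> T k j" for p
      using that first_violation_unique[OF assms] by (cases p) auto
  qed (simp add: assms)
  then show ?thesis by (simp add: row_cancel_def)
qed

text \<open>The sum is its own negative, and integer coefficients have no 2-torsion. This covers
  tableaux fixed by the toggle, whose exponents j and j + 1 are equal.\<close>

lemma sum_sign_reversing:
  fixes g :: "'a \<Rightarrow> zpoly"
  assumes "\<And>x. x \<in> B \<Longrightarrow> \<phi> x \<in> B" "\<And>x. x \<in> B \<Longrightarrow> \<phi> (\<phi> x) = x" "\<And>x. x \<in> B \<Longrightarrow> g (\<phi> x) = - g x"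
  shows "sum g B = 0"
proof -
  have "sum g B = (\<Sum>x\<in>B. g (\<phi> x))"
    by (rule sum.reindex_bij_witness[of _ \<phi> \<phi>]) (simp_all add: assms)
  also have "\<dots> = - sum g B"
    by (simp add: assms(3) sum_negf)
  finally have "lookup (sum g B) m = - lookup (sum g B) m" for m
    by (metis lookup_uminus)
  then show ?thesis by (intro poly_mapping_eqI) simp
qed

text \<open>The coefficient at m counts the tableaux of weight m, so the sum over exponent vectors
  unfolds into one over tableaux.\<close>

lemma alternant_mult_tableau_series_all:
  assumes \<beta>: "\<beta> \<in> compositions_upto n"
  shows "alternant n \<beta> * truncate_vars n (tableau_series lam \<kappa>) =
    (\<Sum>T | semistandard_tableau lam \<kappa> T \<and> weight T \<in> compositions_upto n. alternant n (\<beta> + weight T))"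
proof -
  let ?K = "Poly_Mapping.keys (truncate_vars n (tableau_series lam \<kappa>))"
  let ?U = "{T. semistandard_tableau lam \<kappa> T \<and> weight T \<in> compositions_upto n}"
  have "of_int (sf_coeff (tableau_series lam \<kappa>) m) * alternant n (\<beta> + m) =
      (\<Sum>T\<in>{T \<in> ?U. weight T = m}. alternant n (\<beta> + weight T))" if "m \<in> ?K" for m
  proof -
    have "m \<in> compositions_upto n"
      using that by (auto simp: in_keys_iff lookup_truncate_vars split: if_splits)
    then have "{T \<in> ?U. weight T = m} = {T. semistandard_tableau lam \<kappa> T \<and> weight T = m}"
      by auto
    then show ?thesis by (simp add: tableau_series.rep_eq)
  qed
  then have "alternant n \<beta> * truncate_vars n (tableau_series lam \<kappa>) =
      (\<Sum>m\<in>?K. \<Sum>T\<in>{T \<in> ?U. weight T = m}. alternant n (\<beta> + weight T))"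
    unfolding alternant_mult_truncate_vars[OF \<beta>] by (rule sum.cong[OF refl])
  also have "\<dots> = (\<Sum>T\<in>?U. alternant n (\<beta> + weight T))"
  proof (rule sum.group)
    show "weight ` ?U \<subseteq> ?K"
    proof (safe)
      fix T assume T: "semistandard_tableau lam \<kappa> T" "weight T \<in> compositions_upto n"
      have "card {T'. semistandard_tableau lam \<kappa> T' \<and> weight T' = weight T} \<noteq> 0"
        using T finite_tableaux_weight[of lam \<kappa> "weight T"] by (subst card_0_eq) auto
      then show "weight T \<in> ?K"
        using T(2) by (simp add: in_keys_iff lookup_truncate_vars tableau_series.rep_eq)
    qed
  qed (simp_all add: finite_tableaux_upto)
  finally show ?thesis .
qed

lemma alternant_mult_tableau_series:
  assumes \<mu>: "\<mu> \<in> partitions" "\<mu> \<in> compositions_upto n"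
  shows "alternant n (staircase n + \<mu>) * truncate_vars n (tableau_series lam \<kappa>) =
    (\<Sum>T | semistandard_tableau lam \<kappa> T \<and> weight T \<in> compositions_upto n \<and> (\<forall>k j. \<not> violation \<mu> T k j).
      alternant n (staircase n + (\<mu> + weight T)))"
proof -
  let ?U = "{T. semistandard_tableau lam \<kappa> T \<and> weight T \<in> compositions_upto n}"
  let ?B = "{T \<in> ?U. \<exists>k j. violation \<mu> T k j}" and ?G = "{T \<in> ?U. \<forall>k j. \<not> violation \<mu> T k j}"
  let ?g = "\<lambda>T. alternant n (staircase n + (\<mu> + weight T))"
  have first: "\<exists>k j. first_violation \<mu> T k j \<and> Suc j < n" if TB: "T \<in> ?B" for T
  proof -
    have T: "semistandard_tableau lam \<kappa> T" "weight T \<in> compositions_upto n" using TB by auto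
    obtain k0 j0 where "violation \<mu> T k0 j0" using TB by blast
    then obtain k j where "first_violation \<mu> T k j"
      by (rule first_violation_exists[OF T \<mu>(2)])
    then show ?thesis
      using violation_index[OF T \<mu>(2)] by (auto simp: first_violation_def)
  qed
  have "sum ?g ?B = 0"
  proof (rule sum_sign_reversing[where \<phi> = "row_cancel \<mu>"])
    fix T assume TB: "T \<in> ?B"
    obtain k j where kj: "first_violation \<mu> T k j" "Suc j < n" using first[OF TB] by blast
    have T: "semistandard_tableau lam \<kappa> T" "weight T \<in> compositions_upto n" using TB by auto
    note t = first_violation_toggle[OF T(1) \<mu>(1) kj(1)]
    let ?T = "violation_toggle \<mu> k j T"
    have eq: "row_cancel \<mu> T = ?T" by (rule row_cancel_eq[OF kj(1)])
    have upto: "staircase n + (\<mu> + weight T) \<in> compositions_upto n"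
      using T(2) \<mu>(2) by simp
    show "?g (row_cancel \<mu> T) = - ?g T"
      unfolding eq t(4)[OF kj(2)] by (rule alternant_transpose[OF upto kj(2)])
    show "row_cancel \<mu> (row_cancel \<mu> T) = T"
      using t(2,3) by (simp add: eq row_cancel_eq)
    \<comment> \<open>That the toggled weight needs no further variables is read off from the
      exponent vector, in which two positions below n are exchanged.\<close>
    have "Transposition.transpose j (Suc j) permutes {..<n}"
      using kj(2) by (intro permutes_swap_id) auto
    then have "staircase n + (\<mu> + weight ?T) \<in> compositions_upto n"
      unfolding t(4)[OF kj(2)] using upto by (simp add: map_key_permutes_upto)
    then have "weight ?T \<in> compositions_upto n" by simp
    then show "row_cancel \<mu> T \<in> ?B"
      using t(1,2) by (auto simp: eq first_violation_def)
  qed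
  moreover have "sum ?g ?U = sum ?g ?B + sum ?g ?G"
    by (subst sum.union_disjoint[symmetric])
      (auto intro!: arg_cong2[where f = sum] finite_subset[OF _ finite_tableaux_upto[of lam \<kappa> n]])
  moreover have "alternant n (staircase n + \<mu>) * truncate_vars n (tableau_series lam \<kappa>) = sum ?g ?U"
    using \<mu>(2) by (subst alternant_mult_tableau_series_all) (simp_all add: add.assoc)
  moreover have "?G = {T. semistandard_tableau lam \<kappa> T \<and> weight T \<in> compositions_upto n \<and>
      (\<forall>k j. \<not> violation \<mu> T k j)}" by auto
  ultimately show ?thesis by simp
qed

section \<open>Tableaux and their integral encodings\<close>

text \<open>The only sequence that starts at \<kappa> and has encoding M. It turns tableaux into
  conditions on matrices, which can then be transposed.\<close>

definition partial_shape :: "composition \<Rightarrow> matrix \<Rightarrow> nat \<Rightarrow> composition" where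
  "partial_shape \<kappa> M l = \<kappa> + (\<Sum>j<l. mat_col M j)"

lemma lookup_partial_shape:
  "lookup (partial_shape \<kappa> M l) i = lookup \<kappa> i + (\<Sum>j<l. lookup M (i, j))"
  by (simp add: partial_shape_def lookup_add lookup_sum)

lemma partial_shape_0 [simp]: "partial_shape \<kappa> M 0 = \<kappa>"
  by (simp add: partial_shape_def)

lemma partial_shape_Suc: "partial_shape \<kappa> M (Suc l) = partial_shape \<kappa> M l + mat_col M l"
  by (simp add: partial_shape_def add.assoc)

lemma integral_encoding_iff:
  "integral_encoding T M \<longleftrightarrow> (\<forall>j. T (Suc j) = T j + mat_col M j)"
proof -
  have "int m = int a - int b \<longleftrightarrow> a = b + m" for a b m :: nat
    by linarith
  then have "integral_encoding T M \<longleftrightarrow> (\<forall>i j. lookup (T (Suc j)) i = lookup (T j) i + lookup M (i, j))"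
    by (simp add: integral_encoding_def lookup_minus)
  then show ?thesis
    unfolding poly_mapping_eq_iff fun_eq_iff lookup_add lookup_mat_col by blast
qed

lemma integral_encoding_partial_shape: "integral_encoding (partial_shape \<kappa> M) M"
  by (simp add: integral_encoding_iff partial_shape_Suc)

lemma integral_encoding_imp_eq:
  assumes "integral_encoding T M"
  shows "T = partial_shape (T 0) M"
proof
  fix l
  show "T l = partial_shape (T 0) M l"
    using assms by (induction l) (simp_all add: integral_encoding_iff partial_shape_Suc)
qed

lemma matrix_bound:
  obtains n where "\<And>i j. n \<le> i \<or> n \<le> j \<Longrightarrow> lookup (M :: matrix) (i, j) = 0"
proof
  let ?n = "Suc (Max (insert 0 (fst ` Poly_Mapping.keys M \<union> snd ` Poly_Mapping.keys M)))"
  fix i j assume n: "?n \<le> i \<or> ?n \<le> j"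
  show "lookup M (i, j) = 0"
  proof (rule ccontr)
    assume "lookup M (i, j) \<noteq> 0"
    then have "(i, j) \<in> Poly_Mapping.keys M" by (simp add: in_keys_iff)
    then have "i \<in> fst ` Poly_Mapping.keys M" "j \<in> snd ` Poly_Mapping.keys M"
      by (metis fst_conv imageI, metis snd_conv imageI)
    then have "i < ?n" "j < ?n"
      unfolding less_Suc_eq_le by (auto intro: Max_ge)
    with n show False by simp
  qed
qed

lemma row_sums_eq:
  assumes "\<And>i j. n \<le> j \<Longrightarrow> lookup M (i, j) = 0"
  shows "row_sums M = (\<Sum>j<n. mat_col M j)"
proof (rule poly_mapping_eqI)
  fix i
  have "j < n" if "lookup M (i, j) \<noteq> 0" for j
    using that assms[of j i] by (cases "n \<le> j") auto
  then have "{j. lookup M (i, j) \<noteq> 0} \<subseteq> {..<n}" by blast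
  then have "(\<Sum>j | lookup M (i, j) \<noteq> 0. lookup M (i, j)) = (\<Sum>j<n. lookup M (i, j))"
    by (intro sum.mono_neutral_left) auto
  then show "lookup (row_sums M) i = lookup (\<Sum>j<n. mat_col M j) i"
    by (simp add: row_sums.rep_eq lookup_sum)
qed

lemma lookup_col_sums: "lookup (col_sums M) j = csize (mat_col M j)"
proof -
  have "Poly_Mapping.keys (mat_col M j) = {i. lookup M (i, j) \<noteq> 0}"
    by (auto simp: in_keys_iff)
  then show ?thesis by (simp add: col_sums.rep_eq csize_def)
qed

lemma row_sums_transpose [simp]: "row_sums (mat_transpose M) = col_sums M"
  by (rule poly_mapping_eqI) (simp add: row_sums.rep_eq col_sums.rep_eq)

lemma mat_col_transpose [simp]: "mat_col (mat_transpose M) i = mat_row M i"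
  by (rule poly_mapping_eqI) simp

lemma mat_transpose_transpose [simp]: "mat_transpose (mat_transpose M) = M"
  by (rule poly_mapping_eqI) (metis lookup_mat_transpose surj_pair)

lemma semistandard_partial_shape_iff:
  "semistandard_tableau lam \<kappa> (partial_shape \<kappa> M) \<longleftrightarrow>
     (\<forall>l. partial_shape \<kappa> M l \<leftharpoondown> partial_shape \<kappa> M (Suc l)) \<and> \<kappa> + row_sums M = lam"
proof -
  obtain n where n: "\<And>i j. n \<le> i \<or> n \<le> j \<Longrightarrow> lookup M (i, j) = 0" by (rule matrix_bound) blast
  have eventually: "partial_shape \<kappa> M N = \<kappa> + row_sums M" if "N \<ge> n" for N
    using n that by (simp add: partial_shape_def row_sums_eq[of N])
  then have "(\<exists>N\<^sub>0. \<forall>N\<ge>N\<^sub>0. partial_shape \<kappa> M N = lam) \<longleftrightarrow> \<kappa> + row_sums M = lam"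
    by (metis max.cobounded1 max.cobounded2)
  then show ?thesis
    unfolding semistandard_tableau_def by (auto intro: interlacesD(1))
qed

lemma Tabl_iff_semistandard:
  "M \<in> Tabl lam \<kappa> \<longleftrightarrow> semistandard_tableau lam \<kappa> (partial_shape \<kappa> M)"
  unfolding Tabl_def mem_Collect_eq
  using integral_encoding_partial_shape integral_encoding_imp_eq tableauD(1) by metis

lemma Tabl_iff:
  "M \<in> Tabl lam \<kappa> \<longleftrightarrow>
     (\<forall>l. partial_shape \<kappa> M l \<leftharpoondown> partial_shape \<kappa> M (Suc l)) \<and> \<kappa> + row_sums M = lam"
  by (simp add: Tabl_iff_semistandard semistandard_partial_shape_iff)

lemma Tabl_imp_partitions: "M \<in> Tabl lam \<kappa> \<Longrightarrow> lam \<in> partitions"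
  by (auto simp: Tabl_def semistandard_tableau_def)

lemma weight_partial_shape:
  assumes "M \<in> Tabl lam \<kappa>"
  shows "weight (partial_shape \<kappa> M) = col_sums M"
  using csize_tableau_Suc[OF assms[unfolded Tabl_iff_semistandard]]
  by (intro poly_mapping_eqI) (simp add: partial_shape_Suc lookup_col_sums)

lemma integral_encoding_exists:
  assumes T: "semistandard_tableau lam \<kappa> T"
  obtains M where "integral_encoding T M"
proof
  let ?f = "\<lambda>(i, j). lookup (T (Suc j)) i - lookup (T j) i"
  obtain n where n: "\<And>N. N \<ge> n \<Longrightarrow> T N = lam"
    using assms by (rule tableau_eventually) blast
  have "i \<in> Poly_Mapping.keys lam \<and> j < n" if "?f (i, j) \<noteq> 0" for i j
    using that tableau_le[OF T, of "Suc j" i] n[of j] n[of "Suc j"]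
    by (cases "n \<le> j") (auto simp: in_keys_iff)
  then have "p \<in> Poly_Mapping.keys lam \<times> {..<n}" if "?f p \<noteq> 0" for p
    using that by (cases p) simp
  then have "{p. ?f p \<noteq> 0} \<subseteq> Poly_Mapping.keys lam \<times> {..<n}" by blast
  then have "finite {p. ?f p \<noteq> 0}" by (rule finite_subset) simp
  then have "lookup (Abs_poly_mapping ?f) = ?f" by simp
  then show "integral_encoding T (Abs_poly_mapping ?f)"
    using tableau_mono[OF T, of j "Suc j" for j]
    unfolding integral_encoding_iff by (intro allI poly_mapping_eqI) (simp add: lookup_add)
qed

text \<open>The contributions of \<kappa> and of the columns before j cancel. What remains is one
  half of the interlacing for step k of the transpose; the other half holds because matrix entries
  are nonnegative.\<close>

lemma no_violation_iff:
  "(\<forall>j. \<not> violation \<mu> (partial_shape \<kappa> M) k j) \<longleftrightarrow>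
     partial_shape \<mu> (mat_transpose M) k \<leftharpoondown> partial_shape \<mu> (mat_transpose M) (Suc k)"
  by (simp add: interlaces_iff violation_def lookup_partial_shape row_sum_upto_def sum.distrib not_less)

section \<open>Pairs of tableaux with transposed encodings\<close>

definition tableau_pairs ::
    "composition \<Rightarrow> composition \<Rightarrow> composition \<Rightarrow> composition \<Rightarrow> matrix set" where
  "tableau_pairs lam \<kappa> \<nu> \<mu> = {M. M \<in> Tabl lam \<kappa> \<and> mat_transpose M \<in> Tabl \<nu> \<mu>}"

lemma card_tableau_pairs_commute: "card (tableau_pairs lam \<kappa> \<nu> \<mu>) = card (tableau_pairs \<nu> \<mu> lam \<kappa>)"
  by (rule bij_betw_same_card[of mat_transpose], rule bij_betw_byWitness[of _ mat_transpose])
    (auto simp: tableau_pairs_def)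

text \<open>All rows pass the test exactly when the transposed encoding builds up a tableau from
  \<mu>. It ends at \<mu> plus the weight, because the column sums of an encoding are the
  weight.\<close>

lemma no_violation_tableaux_eq:
  "{T. semistandard_tableau lam \<kappa> T \<and> (\<forall>k j. \<not> violation \<mu> T k j) \<and> \<mu> + weight T = \<nu>} =
     partial_shape \<kappa> ` tableau_pairs lam \<kappa> \<nu> \<mu>"
proof -
  have pair: "M \<in> tableau_pairs lam \<kappa> \<nu> \<mu> \<longleftrightarrow> semistandard_tableau lam \<kappa> (partial_shape \<kappa> M) \<and>
      (\<forall>k j. \<not> violation \<mu> (partial_shape \<kappa> M) k j) \<and> \<mu> + weight (partial_shape \<kappa> M) = \<nu>" for M
  proof (cases "M \<in> Tabl lam \<kappa>")
    case True
    then show ?thesis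
      using weight_partial_shape[OF True] True[unfolded Tabl_iff_semistandard]
      by (simp add: tableau_pairs_def True Tabl_iff[of "mat_transpose M"] no_violation_iff)
  qed (simp add: tableau_pairs_def Tabl_iff_semistandard)
  have "\<exists>M. T = partial_shape \<kappa> M" if "semistandard_tableau lam \<kappa> T" for T
    using integral_encoding_exists[OF that] integral_encoding_imp_eq tableauD(1)[OF that] by metis
  then show ?thesis using pair by blast
qed

lemma inj_partial_shape: "inj (partial_shape \<kappa>)"
proof (rule injI)
  fix M N assume eq: "partial_shape \<kappa> M = partial_shape \<kappa> N"
  have "mat_col M j = mat_col N j" for j
    using fun_cong[OF eq, of "Suc j"] fun_cong[OF eq, of j] by (simp add: partial_shape_Suc)
  then have "lookup M (i, j) = lookup N (i, j)" for i j
    by (metis lookup_mat_col)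
  then show "M = N" by (intro poly_mapping_eqI) (metis surj_pair)
qed

lemma card_no_violation_tableaux:
  "card {T. semistandard_tableau lam \<kappa> T \<and> (\<forall>k j. \<not> violation \<mu> T k j) \<and> \<mu> + weight T = \<nu>} =
     card (tableau_pairs lam \<kappa> \<nu> \<mu>)"
  unfolding no_violation_tableaux_eq
  by (intro card_image inj_on_subset[OF inj_partial_shape]) simp

text \<open>The sum is the final partition of the tableau that the transposed encoding builds
  up.\<close>

lemma no_violation_imp_partition:
  assumes "semistandard_tableau lam \<kappa> T" "\<forall>k j. \<not> violation \<mu> T k j"
  shows "\<mu> + weight T \<in> partitions"
proof -
  have "T \<in> partial_shape \<kappa> ` tableau_pairs lam \<kappa> (\<mu> + weight T) \<mu>"
    unfolding no_violation_tableaux_eq[symmetric] using assms by simp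
  then show ?thesis by (auto simp: tableau_pairs_def dest: Tabl_imp_partitions)
qed

section \<open>Straight shapes and diagonal matrices\<close>

lift_definition diagonal :: "composition \<Rightarrow> matrix" is "\<lambda>\<alpha> (i, j). if i = j then \<alpha> i else 0"
proof -
  fix \<alpha> :: "nat \<Rightarrow> nat" assume "finite {x. \<alpha> x \<noteq> 0}"
  then have "finite ((\<lambda>i. (i, i)) ` {x. \<alpha> x \<noteq> 0})" by simp
  then show "finite {x. (case x of (i, j) \<Rightarrow> if i = j then \<alpha> i else 0) \<noteq> 0}"
    by (rule rev_finite_subset) (auto split: if_splits)
qed

lemma lookup_diagonal: "lookup (diagonal \<alpha>) (i, j) = (if i = j then lookup \<alpha> i else 0)"
  by (simp add: diagonal.rep_eq)

lemma transpose_diagonal [simp]: "mat_transpose (diagonal \<alpha>) = diagonal \<alpha>"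
  by (rule poly_mapping_eqI) (auto simp: lookup_diagonal)

lemma lookup_partial_shape_diagonal:
  "lookup (partial_shape 0 (diagonal \<alpha>) l) i = (if i < l then lookup \<alpha> i else 0)"
  by (simp add: lookup_partial_shape lookup_diagonal)

lemma row_sums_diagonal: "row_sums (diagonal \<alpha>) = \<alpha>"
proof (rule poly_mapping_eqI)
  fix i
  have "{j. lookup (diagonal \<alpha>) (i, j) \<noteq> 0} = (if lookup \<alpha> i = 0 then {} else {i})"
    by (auto simp: lookup_diagonal)
  then show "lookup (row_sums (diagonal \<alpha>)) i = lookup \<alpha> i"
    by (simp add: row_sums.rep_eq lookup_diagonal)
qed

lemma diagonal_Tabl:
  assumes "lam \<in> partitions"
  shows "diagonal lam \<in> Tabl lam 0"
  using assms
  by (auto simp: Tabl_iff row_sums_diagonal interlaces_iff lookup_partial_shape_diagonal partitions_def)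

text \<open>Row i + 1 of T(j+1) is bounded by row i of T(j), so each new letter opens at most one
  further row.\<close>

lemma straight_tableau_lookup_eq_0:
  assumes T: "semistandard_tableau lam 0 T" and "j \<le> i"
  shows "lookup (T j) i = 0"
  using assms(2)
proof (induction j arbitrary: i)
  case 0
  then show ?case by (simp add: tableauD(1)[OF T])
next
  case (Suc j)
  then obtain i' where "i = Suc i'" "j \<le> i'" by (cases i) auto
  then show ?case
    using Suc.IH[of i'] interlacesD(3)[OF tableauD(2)[OF T], of j i'] by simp
qed

lemma straight_Tabl_lookup_eq_0:
  assumes M: "M \<in> Tabl lam 0" and "j < i"
  shows "lookup M (i, j) = 0"
  using straight_tableau_lookup_eq_0[OF M[unfolded Tabl_iff_semistandard], of "Suc j" i] assms(2)
  by (simp add: partial_shape_Suc lookup_add)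

text \<open>The matrix and its transpose are both upper triangular.\<close>

lemma straight_tableau_pairs:
  assumes lam: "lam \<in> partitions"
  shows "tableau_pairs lam 0 \<nu> 0 = (if \<nu> = lam then {diagonal lam} else {})"
proof -
  have eq: "M = diagonal lam \<and> \<nu> = lam" if M: "M \<in> tableau_pairs lam 0 \<nu> 0" for M
  proof -
    have M1: "M \<in> Tabl lam 0" and M2: "mat_transpose M \<in> Tabl \<nu> 0"
      using M by (auto simp: tableau_pairs_def)
    have 0: "lookup M (i, j) = 0" if "i \<noteq> j" for i j
      using straight_Tabl_lookup_eq_0[OF M1, of j i] straight_Tabl_lookup_eq_0[OF M2, of i j] that
      by (cases i j rule: linorder_cases) auto
    define d :: composition where "d = Poly_Mapping.map_key (\<lambda>i. (i, i)) M"
    have "lookup d i = lookup M (i, i)" for i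
      by (simp add: d_def map_key.rep_eq inj_def)
    then have Md: "M = diagonal d"
      using 0 by (intro poly_mapping_eqI) (auto simp: lookup_diagonal)
    then show ?thesis
      using M1 M2 by (simp add: Tabl_iff row_sums_diagonal)
  qed
  have diag: "diagonal lam \<in> tableau_pairs lam 0 lam 0"
    using diagonal_Tabl[OF lam] by (simp add: tableau_pairs_def)
  show ?thesis
  proof (cases "\<nu> = lam")
    case True
    then have "tableau_pairs lam 0 \<nu> 0 = {diagonal lam}"
      using eq diag by blast
    then show ?thesis using True by simp
  next
    case False
    then have "tableau_pairs lam 0 \<nu> 0 = {}"
      using eq by blast
    then show ?thesis using False by simp
  qed
qed

section \<open>Schur functions as generating series of tableaux\<close>

text \<open>A single tableau, of weight lam, survives the cancellation. If lam is longer than n, it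
  uses a letter beyond the variables and nothing is left, in accordance with the value 0 of
  \<open>schur_poly\<close>.\<close>

lemma vandermonde_mult_straight:
  assumes lam: "lam \<in> partitions"
  shows "alternant n (staircase n) * truncate_vars n (tableau_series lam 0) =
    (if lam \<in> compositions_upto n then alternant n (staircase n + lam) else 0)"
proof -
  let ?G = "\<lambda>\<nu>. {T. semistandard_tableau lam 0 T \<and> (\<forall>k j. \<not> violation 0 T k j) \<and> 0 + weight T = \<nu>}"
  let ?S = "{T. semistandard_tableau lam 0 T \<and> weight T \<in> compositions_upto n \<and>
      (\<forall>k j. \<not> violation 0 T k j)}"
  have w: "weight T = lam" if T: "semistandard_tableau lam 0 T" "\<forall>k j. \<not> violation 0 T k j" for T
  proof (rule ccontr)
    assume "weight T \<noteq> lam"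
    then have "?G (weight T) = {}"
      unfolding no_violation_tableaux_eq by (simp add: straight_tableau_pairs[OF lam])
    then show False using T by auto
  qed
  have "alternant n (staircase n) * truncate_vars n (tableau_series lam 0) =
      (\<Sum>T\<in>?S. alternant n (staircase n + (0 + weight T)))"
    using alternant_mult_tableau_series[of 0 n lam 0] by simp
  also have "\<dots> = (\<Sum>T\<in>?S. alternant n (staircase n + lam))"
    using w by (intro sum.cong) auto
  also have "\<dots> = (if lam \<in> compositions_upto n then alternant n (staircase n + lam) else 0)"
  proof (cases "lam \<in> compositions_upto n")
    case True
    then have "?S = ?G lam" using w by auto
    then have "card ?S = 1"
      by (simp only: card_no_violation_tableaux) (simp add: straight_tableau_pairs[OF lam])
    then show ?thesis using True by simp
  next
    case False
    then have S: "?S = {}" using w by blast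
    show ?thesis unfolding S using False by simp
  qed
  finally show ?thesis .
qed

lemma truncate_straight:
  assumes lam: "lam \<in> partitions"
  shows "truncate_vars n (tableau_series lam 0) = schur_poly n lam"
proof (cases "lam \<in> compositions_upto n")
  case True
  note eq = vandermonde_mult_straight[OF lam, of n]
  have "(THE q. q * alternant n (staircase n) = alternant n (staircase n + lam)) =
      truncate_vars n (tableau_series lam 0)"
  proof (rule the_equality)
    show "truncate_vars n (tableau_series lam 0) * alternant n (staircase n) = alternant n (staircase n + lam)"
      using eq True by (simp add: mult.commute)
    fix q assume "q * alternant n (staircase n) = alternant n (staircase n + lam)"
    then have "q * alternant n (staircase n) =
        truncate_vars n (tableau_series lam 0) * alternant n (staircase n)"
      using eq True by (simp add: mult.commute)
    then show "q = truncate_vars n (tableau_series lam 0)"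
      using vandermonde_nonzero by simp
  qed
  then show ?thesis using True by (simp add: schur_poly_def)
next
  case False
  then show ?thesis
    using vandermonde_mult_straight[OF lam, of n] vandermonde_nonzero by (simp add: schur_poly_def)
qed

lemma schur_eq:
  assumes "lam \<in> partitions"
  shows "schur lam = tableau_series lam 0"
  unfolding schur_def
  by (rule the_equality) (auto simp: truncate_straight[OF assms] intro: truncate_vars_eqD)

lemma vandermonde_mult_schur:
  assumes "lam \<in> partitions"
  shows "alternant n (staircase n) * truncate_vars n (schur lam) =
    (if lam \<in> compositions_upto n then alternant n (staircase n + lam) else 0)"
  by (simp add: schur_eq[OF assms] vandermonde_mult_straight[OF assms])

lemma schur_0: "schur 0 = 1"
proof (rule truncate_vars_eqD)
  fix n
  have "alternant n (staircase n) * truncate_vars n (schur 0) = alternant n (staircase n) * 1"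
    by (simp add: vandermonde_mult_schur)
  then have "truncate_vars n (schur 0) = 1"
    using vandermonde_nonzero mult_left_cancel by blast
  also have "\<dots> = truncate_vars n 1"
    by (rule poly_mapping_eqI) (auto simp: lookup_truncate_vars one_symfun.rep_eq lookup_one when_def)
  finally show "truncate_vars n (schur 0) = truncate_vars n 1" .
qed

text \<open>Any number of variables that is at least the length of \<open>\<nu>\<close> would do.\<close>

definition schur_coeff :: "composition \<Rightarrow> symfun \<Rightarrow> int" where
  "schur_coeff \<nu> f = lookup (alternant (csize \<nu>) (staircase (csize \<nu>)) * truncate_vars (csize \<nu>) f)
     (staircase (csize \<nu>) + \<nu>)"

lemma additive_schur_coeff: "additive (schur_coeff \<nu>)"
  by unfold_locales (simp add: schur_coeff_def truncate_vars_add distrib_left lookup_add)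

lemma schur_coeff_schur:
  assumes "\<nu> \<in> partitions" "\<mu> \<in> partitions"
  shows "schur_coeff \<nu> (schur \<mu>) = of_bool (\<mu> = \<nu>)"
  using partitions_in_upto_csize[OF assms(1)]
  by (auto simp: schur_coeff_def vandermonde_mult_schur[OF assms(2)] lookup_alternant_staircase assms)

text \<open>The Vandermonde determinant absorbs \<open>schur \<mu>\<close> into an alternant. After
  the cancellation all exponents are \<delta> plus a partition, so the coefficient at \<delta> +
  \<nu> counts the tableaux that end at \<nu>.\<close>

lemma schur_coeff_schur_mult_tableau_series:
  assumes \<nu>: "\<nu> \<in> partitions" and \<mu>: "\<mu> \<in> partitions"
  shows "schur_coeff \<nu> (schur \<mu> * tableau_series lam \<kappa>) = int (card (tableau_pairs lam \<kappa> \<nu> \<mu>))"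
proof -
  define n where "n = csize \<nu>"
  have \<nu>n: "\<nu> \<in> compositions_upto n"
    unfolding n_def by (rule partitions_in_upto_csize[OF \<nu>])
  have "schur_coeff \<nu> (schur \<mu> * tableau_series lam \<kappa>) =
      lookup (alternant n (staircase n) * truncate_vars n (schur \<mu>) * truncate_vars n (tableau_series lam \<kappa>))
        (staircase n + \<nu>)"
    by (simp add: schur_coeff_def n_def truncate_vars_mult mult.assoc)
  also have "\<dots> = int (card {T. semistandard_tableau lam \<kappa> T \<and> (\<forall>k j. \<not> violation \<mu> T k j) \<and>
      \<mu> + weight T = \<nu>})" (is "_ = int (card ?G)")
  proof (cases "\<mu> \<in> compositions_upto n")
    case True
    let ?S = "{T. semistandard_tableau lam \<kappa> T \<and> weight T \<in> compositions_upto n \<and>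
      (\<forall>k j. \<not> violation \<mu> T k j)}"
    have "lookup (alternant n (staircase n) * truncate_vars n (schur \<mu>) * truncate_vars n (tableau_series lam \<kappa>))
        (staircase n + \<nu>) = (\<Sum>T\<in>?S. of_bool (\<mu> + weight T = \<nu>))"
      using no_violation_imp_partition True
      by (auto simp: vandermonde_mult_schur[OF \<mu>] alternant_mult_tableau_series[OF \<mu>] lookup_sum
          \<nu> intro!: sum.cong lookup_alternant_staircase)
    also have "\<dots> = int (card {T \<in> ?S. \<mu> + weight T = \<nu>})"
      by (subst sum_of_bool_eq) (auto intro: finite_subset[OF _ finite_tableaux_upto[of lam \<kappa> n]] simp: Int_def)
    also have "{T \<in> ?S. \<mu> + weight T = \<nu>} = ?G"
      using \<nu>n by auto
    finally show ?thesis .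
  next
    case False
    \<comment> \<open>If \<mu> is longer than n, then so is \<mu> plus any weight, and it cannot
      equal \<nu>.\<close>
    then have G: "?G = {}" using \<nu>n by auto
    show ?thesis unfolding G using False by (simp add: vandermonde_mult_schur[OF \<mu>])
  qed
  finally show ?thesis by (simp only: card_no_violation_tableaux)
qed

section \<open>Schur functions form a basis\<close>

text \<open>Partitions represent the orbits of exponent vectors, so their coefficients determine a
  symmetric function.\<close>

lemma rearrange_to_partition:
  fixes m :: composition
  obtains \<pi> where "bij \<pi>" "Poly_Mapping.map_key \<pi> m \<in> partitions"
proof -
  obtain n where n: "m \<in> compositions_upto n" by (rule composition_bound)
  define xs where "xs = map (lookup m) [0..<n]"
  have "mset (rev (sort xs)) = mset xs" by simp
  then obtain \<pi> where \<pi>: "\<pi> permutes {..<length xs}" "permute_list \<pi> xs = rev (sort xs)"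
    by (rule mset_eq_permutation)
  have \<pi>n: "\<pi> permutes {..<n}" using \<pi>(1) by (simp add: xs_def)
  have sorted: "lookup m (\<pi> i) = rev (sort xs) ! i" if "i < n" for i
  proof -
    have "\<pi> i < n" using permutes_in_image[OF \<pi>n, of i] that by simp
    moreover have "length xs = n" "xs ! \<pi> i = lookup m (\<pi> i)"
      using \<open>\<pi> i < n\<close> by (simp_all add: xs_def)
    ultimately show ?thesis
      using permute_list_nth[OF \<pi>(1), of i] that by (simp add: \<pi>(2))
  qed
  have "lookup m (\<pi> (Suc i)) \<le> lookup m (\<pi> i)" for i
  proof (cases "Suc i < n")
    case True
    have "rev (sort xs) ! Suc i \<le> rev (sort xs) ! i"
      using True sorted_rev_nth_mono[of "rev (sort xs)" i "Suc i"] by (simp add: xs_def)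
    then show ?thesis using True by (simp add: sorted)
  next
    case False
    then show ?thesis
      using n permutes_not_in[OF \<pi>n, of "Suc i"] by (simp add: compositions_upto_def)
  qed
  then have "Poly_Mapping.map_key \<pi> m \<in> partitions"
    by (simp add: partitions_def map_key.rep_eq permutes_inj[OF \<pi>n])
  then show thesis using permutes_bij[OF \<pi>n] by (rule that[rotated])
qed

lemma symfun_eq_0I:
  assumes "\<And>\<nu>. \<nu> \<in> partitions \<Longrightarrow> sf_coeff f \<nu> = 0"
  shows "f = 0"
proof (rule symfun_eqI)
  fix m :: composition
  obtain \<pi> where \<pi>: "bij \<pi>" "Poly_Mapping.map_key \<pi> m \<in> partitions"
    by (rule rearrange_to_partition)
  from \<pi>(1) have "sf_coeff f m = sf_coeff f (Poly_Mapping.map_key \<pi> m)"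
    using sf_coeff[of f] by auto
  then show "sf_coeff f m = sf_coeff 0 m"
    using assms[OF \<pi>(2)] by (simp add: zero_symfun.rep_eq)
qed

section \<open>Unitriangularity and spanning\<close>

lemma straight_tableau_le_diagonal:
  assumes T: "semistandard_tableau lam 0 T"
  shows "lookup (T j) i \<le> lookup (partial_shape 0 (diagonal lam) j) i"
  using tableau_le[OF T, of j i] straight_tableau_lookup_eq_0[OF T, of j i]
  by (cases "i < j") (simp_all add: lookup_partial_shape_diagonal)

lemma diagonal_tableau:
  assumes "lam \<in> partitions"
  shows "semistandard_tableau lam 0 (partial_shape 0 (diagonal lam))"
    and "weight (partial_shape 0 (diagonal lam)) = lam"
proof -
  note D = diagonal_Tabl[OF assms]
  then show "semistandard_tableau lam 0 (partial_shape 0 (diagonal lam))"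
    by (simp add: Tabl_iff_semistandard)
  show "weight (partial_shape 0 (diagonal lam)) = lam"
    using weight_partial_shape[OF D] row_sums_transpose[of "diagonal lam"]
    by (simp add: row_sums_diagonal)
qed

text \<open>The order on finitely supported functions is lexicographic, starting at index 0. It is
  linear and extends dominance, so leading terms are available.\<close>

lemma dominance_imp_le:
  fixes \<alpha> \<beta> :: composition
  assumes "\<And>j. (\<Sum>i<j. lookup \<alpha> i) \<le> (\<Sum>i<j. lookup \<beta> i)"
  shows "\<alpha> \<le> \<beta>"
proof (cases "\<alpha> = \<beta>")
  case False
  define k where "k = (LEAST i. lookup \<alpha> i \<noteq> lookup \<beta> i)"
  have "\<exists>i. lookup \<alpha> i \<noteq> lookup \<beta> i" using False by (metis poly_mapping_eqI)
  then have k: "lookup \<alpha> k \<noteq> lookup \<beta> k" unfolding k_def by (rule LeastI_ex)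
  have eq: "lookup \<alpha> i = lookup \<beta> i" if "i < k" for i
    using not_less_Least[OF that[unfolded k_def]] by simp
  then have "(\<Sum>i<k. lookup \<alpha> i) = (\<Sum>i<k. lookup \<beta> i)" by simp
  then have "lookup \<alpha> k < lookup \<beta> k"
    using assms[of "Suc k"] k by simp
  then have "\<alpha> < \<beta>"
    using eq by (auto simp: less_poly_mapping.rep_eq less_fun_def)
  then show ?thesis by simp
qed simp

text \<open>Partial sums of the weight are sizes of stages, so comparison with the diagonal tableau
  gives dominance. Weight lam forces equal sizes at every stage and hence the diagonal tableau
  itself.\<close>

lemma schur_unitriangular:
  assumes lam: "lam \<in> partitions"
  shows "sf_coeff (schur lam) lam = 1"
    and "sf_coeff (schur lam) m \<noteq> 0 \<Longrightarrow> m \<le> lam"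
    and "sf_coeff (schur lam) m \<noteq> 0 \<Longrightarrow> csize m = csize lam"
proof -
  let ?D = "partial_shape 0 (diagonal lam)"
  note D = diagonal_tableau[OF lam]
  have "{T. semistandard_tableau lam 0 T \<and> weight T = lam} = {?D}"
  proof (intro equalityI subsetI)
    fix T assume "T \<in> {T. semistandard_tableau lam 0 T \<and> weight T = lam}"
    then have T: "semistandard_tableau lam 0 T" "weight T = lam" by auto
    have "T j = ?D j" for j
    proof (rule csize_eq_imp_eq)
      show "csize (T j) = csize (?D j)"
        by (simp only: csize_tableau[OF T(1)] csize_tableau[OF D(1)] D(2) T(2))
    qed (rule straight_tableau_le_diagonal[OF T(1)])
    then show "T \<in> {?D}" by auto
  qed (use D in auto)
  then show "sf_coeff (schur lam) lam = 1"
    by (simp add: schur_eq[OF lam] tableau_series.rep_eq)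
  assume "sf_coeff (schur lam) m \<noteq> 0"
  then have "{T. semistandard_tableau lam 0 T \<and> weight T = m} \<noteq> {}"
    unfolding schur_eq[OF lam] tableau_series.rep_eq by (metis card.empty of_nat_0)
  then obtain T where T: "semistandard_tableau lam 0 T" "weight T = m" by blast
  show "csize m = csize lam"
    using csize_weight[OF T(1)] T(2) by simp
  show "m \<le> lam"
  proof (rule dominance_imp_le)
    fix j
    have "csize (T j) \<le> csize (?D j)"
      by (rule csize_mono[OF straight_tableau_le_diagonal[OF T(1)]])
    then show "(\<Sum>i<j. lookup m i) \<le> (\<Sum>i<j. lookup lam i)"
      by (simp add: csize_tableau[OF T(1)] csize_tableau[OF D(1)] D(2) T(2))
  qed
qed

text \<open>Adding or subtracting one Schur function at a time yields the induction rule
  \<open>schur_induct\<close>, which fits additive maps.\<close>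

inductive_set schur_span :: "symfun set" where
  zero: "0 \<in> schur_span"
| add: "f \<in> schur_span \<Longrightarrow> \<nu> \<in> partitions \<Longrightarrow> f + schur \<nu> \<in> schur_span"
| diff: "f \<in> schur_span \<Longrightarrow> \<nu> \<in> partitions \<Longrightarrow> f - schur \<nu> \<in> schur_span"

lemma schur_span_add_scaled:
  assumes "f \<in> schur_span" "\<nu> \<in> partitions"
  shows "f + of_int c * schur \<nu> \<in> schur_span"
proof (induction c rule: int_induct[where k = 0])
  case (step1 i)
  have "f + of_int (i + 1) * schur \<nu> = (f + of_int i * schur \<nu>) + schur \<nu>"
    by (simp add: distrib_right)
  then show ?case using schur_span.add[OF step1(2) assms(2)] by (simp only:)
next
  case (step2 i)
  have "f + of_int (i - 1) * schur \<nu> = (f + of_int i * schur \<nu>) - schur \<nu>"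
    by (simp add: left_diff_distrib)
  then show ?case using schur_span.diff[OF step2(2) assms(2)] by (simp only:)
qed (simp add: assms)

lemma sf_coeff_of_int_mult: "sf_coeff (of_int c * f) m = c * sf_coeff f m"
  by (induction c rule: int_induct[where k = 0])
    (simp_all add: zero_symfun.rep_eq plus_symfun.rep_eq minus_symfun.rep_eq algebra_simps)

lemma finite_partitions_csize_le: "finite {\<nu> \<in> partitions. csize \<nu> \<le> d}"
proof (rule finite_subset)
  show "finite {a :: composition. Poly_Mapping.keys a \<subseteq> {..<d} \<and> (\<forall>i. lookup a i \<le> d)}"
    by (rule finite_bounded_compositions) simp
  have "Poly_Mapping.keys \<nu> \<subseteq> {..<d} \<and> (\<forall>i. lookup \<nu> i \<le> d)"
    if "\<nu> \<in> partitions" "csize \<nu> \<le> d" for \<nu>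
  proof -
    have "\<nu> \<in> compositions_upto d"
      using partitions_in_upto_csize[OF that(1)] compositions_upto_mono[OF that(2)] by auto
    then have "lookup \<nu> i = 0" if "d \<le> i" for i using that by (simp add: compositions_upto_def)
    then have "Poly_Mapping.keys \<nu> \<subseteq> {..<d}"
      unfolding subset_iff in_keys_iff lessThan_iff by (meson not_le)
    moreover have "lookup \<nu> i \<le> d" for i
      using lookup_le_csize[of \<nu> i] that(2) by simp
    ultimately show ?thesis by blast
  qed
  then show "{\<nu> \<in> partitions. csize \<nu> \<le> d} \<subseteq>
      {a. Poly_Mapping.keys a \<subseteq> {..<d} \<and> (\<forall>i. lookup a i \<le> d)}" by blast
qed

text \<open>Subtracting a multiple of the Schur function of the largest partition in the support
  removes it but may create smaller terms. The induction therefore runs over the set of all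
  partitions below the support.\<close>

lemma schur_span_bounded_degree:
  assumes "\<And>m. sf_coeff f m \<noteq> 0 \<Longrightarrow> csize m \<le> d"
  shows "f \<in> schur_span"
proof -
  let ?P = "{\<nu> \<in> partitions. csize \<nu> \<le> d}"
  define S where "S f = {\<nu> \<in> ?P. sf_coeff f \<nu> \<noteq> 0}" for f
  define below where "below f = {\<mu> \<in> ?P. \<exists>\<nu>\<in>S f. \<mu> \<le> \<nu>}" for f
  have fin: "finite ?P" by (rule finite_partitions_csize_le)
  have finS: "finite (S f)" for f unfolding S_def by (rule finite_subset[OF _ fin]) blast
  have fin_below: "finite (below f)" for f unfolding below_def by (rule finite_subset[OF _ fin]) blast
  show ?thesis using assms
  proof (induction "card (below f)" arbitrary: f rule: less_induct)
    case less
    show ?case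
    proof (cases "S f = {}")
      case True
      then have "f = 0"
        using less.prems by (intro symfun_eq_0I) (auto simp: S_def)
      then show ?thesis by (simp add: schur_span.zero)
    next
      case False
      define b where "b = Max (S f)"
      have bS: "b \<in> S f" unfolding b_def using finS False by (rule Max_in)
      have b_max: "\<nu> \<le> b" if "\<nu> \<in> S f" for \<nu> unfolding b_def using finS that by (rule Max_ge)
      have bP: "b \<in> partitions" "csize b \<le> d" using bS by (auto simp: S_def)
      define g where "g = f - of_int (sf_coeff f b) * schur b"
      have g: "sf_coeff g m = sf_coeff f m - sf_coeff f b * sf_coeff (schur b) m" for m
        by (simp add: g_def minus_symfun.rep_eq sf_coeff_of_int_mult)
      have deg: "csize m \<le> d" if "sf_coeff g m \<noteq> 0" for m
        using that less.prems[of m] schur_unitriangular(3)[OF bP(1), of m] bP(2)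
        by (cases "sf_coeff (schur b) m = 0") (auto simp: g)
      have Sg: "\<nu> < b" if "\<nu> \<in> S g" for \<nu>
      proof -
        have "sf_coeff g \<nu> \<noteq> 0" "\<nu> \<in> ?P" using that by (auto simp: S_def)
        then have "sf_coeff f \<nu> \<noteq> 0 \<or> sf_coeff (schur b) \<nu> \<noteq> 0" by (auto simp: g)
        then have "\<nu> \<le> b"
          using b_max[of \<nu>] schur_unitriangular(2)[OF bP(1), of \<nu>] \<open>\<nu> \<in> ?P\<close> by (auto simp: S_def)
        moreover have "\<nu> \<noteq> b"
          using \<open>sf_coeff g \<nu> \<noteq> 0\<close> schur_unitriangular(1)[OF bP(1)] by (auto simp: g)
        ultimately show ?thesis by simp
      qed
      have "b \<in> below f" using bS by (auto simp: below_def S_def)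
      moreover have "b \<notin> below g" by (auto simp: below_def dest!: Sg)
      moreover have "below g \<subseteq> below f"
      proof
        fix \<mu> assume "\<mu> \<in> below g"
        then obtain \<nu> where "\<mu> \<in> ?P" "\<nu> \<in> S g" "\<mu> \<le> \<nu>" unfolding below_def by blast
        then have "\<mu> \<le> b" using Sg[of \<nu>] by simp
        then show "\<mu> \<in> below f" using \<open>\<mu> \<in> ?P\<close> bS unfolding below_def by blast
      qed
      ultimately have "card (below g) < card (below f)"
        by (intro psubset_card_mono fin_below) blast
      then have "g \<in> schur_span" using deg by (rule less.hyps)
      then have "g + of_int (sf_coeff f b) * schur b \<in> schur_span"
        using bP(1) by (rule schur_span_add_scaled)
      then show ?thesis by (simp add: g_def)
    qed
  qed
qed

lemma in_schur_span: "f \<in> schur_span"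
proof -
  obtain d where "\<And>m. sf_coeff f m \<noteq> 0 \<Longrightarrow> csize m \<le> d"
    using sf_coeff[of f] by blast
  then show ?thesis by (rule schur_span_bounded_degree)
qed

lemmas schur_induct = schur_span.induct[OF in_schur_span, case_names zero add diff]

interpretation schur_coeff: additive "schur_coeff \<nu>" for \<nu>
  by (rule additive_schur_coeff)

text \<open>F may exceed the support, so that it can simply grow by one partition in each induction
  step, even when coefficients cancel.\<close>

lemma schur_expansion:
  obtains F where "finite F" "F \<subseteq> partitions" "{\<nu> \<in> partitions. schur_coeff \<nu> f \<noteq> 0} \<subseteq> F"
    "f = (\<Sum>\<nu>\<in>F. of_int (schur_coeff \<nu> f) * schur \<nu>)"
proof -
  have insert: "(\<Sum>\<nu>\<in>insert \<rho> F. of_int (schur_coeff \<nu> f) * schur \<nu>) =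
      (\<Sum>\<nu>\<in>F. of_int (schur_coeff \<nu> f) * schur \<nu>)"
    "(\<Sum>\<nu>\<in>insert \<rho> F. of_int (schur_coeff \<nu> (schur \<rho>)) * schur \<nu>) = schur \<rho>"
    if "finite F" "F \<subseteq> partitions" "\<rho> \<in> partitions" "\<rho> \<in> F \<or> schur_coeff \<rho> f = 0" for F f \<rho>
  proof -
    show "(\<Sum>\<nu>\<in>insert \<rho> F. of_int (schur_coeff \<nu> f) * schur \<nu>) =
        (\<Sum>\<nu>\<in>F. of_int (schur_coeff \<nu> f) * schur \<nu>)"
      using that by (intro sum.mono_neutral_right) auto
    have "(\<Sum>\<nu>\<in>insert \<rho> F. of_int (schur_coeff \<nu> (schur \<rho>)) * schur \<nu>) =
        (\<Sum>\<nu>\<in>insert \<rho> F. if \<nu> = \<rho> then schur \<nu> else 0)"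
      using that by (intro sum.cong) (auto simp: schur_coeff_schur)
    then show "(\<Sum>\<nu>\<in>insert \<rho> F. of_int (schur_coeff \<nu> (schur \<rho>)) * schur \<nu>) = schur \<rho>"
      using that(1) by (simp only: sum.delta finite_insert insertI1 if_True)
  qed
  have "\<exists>F. finite F \<and> F \<subseteq> partitions \<and> (\<forall>\<nu>\<in>partitions. schur_coeff \<nu> f \<noteq> 0 \<longrightarrow> \<nu> \<in> F) \<and>
      f = (\<Sum>\<nu>\<in>F. of_int (schur_coeff \<nu> f) * schur \<nu>)"
  proof (induction f rule: schur_induct)
    case zero
    then show ?case by (auto simp: schur_coeff.zero intro!: exI[of _ "{}"])
  next
    case (add f \<rho>)
    then obtain F where F: "finite F" "F \<subseteq> partitions"
      "\<forall>\<nu>\<in>partitions. schur_coeff \<nu> f \<noteq> 0 \<longrightarrow> \<nu> \<in> F"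
      "f = (\<Sum>\<nu>\<in>F. of_int (schur_coeff \<nu> f) * schur \<nu>)" by blast
    have vanish: "\<rho> \<in> F \<or> schur_coeff \<rho> f = 0"
      using F(3) add.hyps(2) by blast
    have "f + schur \<rho> = (\<Sum>\<nu>\<in>insert \<rho> F. of_int (schur_coeff \<nu> (f + schur \<rho>)) * schur \<nu>)"
      by (simp only: schur_coeff.add of_int_add distrib_right sum.distrib
          insert[OF F(1,2) add.hyps(2) vanish] F(4)[symmetric])
    moreover have "\<forall>\<nu>\<in>partitions. schur_coeff \<nu> (f + schur \<rho>) \<noteq> 0 \<longrightarrow> \<nu> \<in> insert \<rho> F"
      using F(3) add.hyps(2) by (auto simp: schur_coeff.add schur_coeff_schur)
    moreover have "finite (insert \<rho> F)" "insert \<rho> F \<subseteq> partitions"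
      using F(1,2) add.hyps(2) by simp_all
    ultimately show ?case by blast
  next
    case (diff f \<rho>)
    then obtain F where F: "finite F" "F \<subseteq> partitions"
      "\<forall>\<nu>\<in>partitions. schur_coeff \<nu> f \<noteq> 0 \<longrightarrow> \<nu> \<in> F"
      "f = (\<Sum>\<nu>\<in>F. of_int (schur_coeff \<nu> f) * schur \<nu>)" by blast
    have vanish: "\<rho> \<in> F \<or> schur_coeff \<rho> f = 0"
      using F(3) diff.hyps(2) by blast
    have "f - schur \<rho> = (\<Sum>\<nu>\<in>insert \<rho> F. of_int (schur_coeff \<nu> (f - schur \<rho>)) * schur \<nu>)"
      by (simp only: schur_coeff.diff of_int_diff left_diff_distrib sum_subtractf
          insert[OF F(1,2) diff.hyps(2) vanish] F(4)[symmetric])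
    moreover have "\<forall>\<nu>\<in>partitions. schur_coeff \<nu> (f - schur \<rho>) \<noteq> 0 \<longrightarrow> \<nu> \<in> insert \<rho> F"
      using F(3) diff.hyps(2) by (auto simp: schur_coeff.diff schur_coeff_schur)
    moreover have "finite (insert \<rho> F)" "insert \<rho> F \<subseteq> partitions"
      using F(1,2) diff.hyps(2) by simp_all
    ultimately show ?case by blast
  qed
  then obtain F where "finite F" "F \<subseteq> partitions"
    "\<forall>\<nu>\<in>partitions. schur_coeff \<nu> f \<noteq> 0 \<longrightarrow> \<nu> \<in> F"
    "f = (\<Sum>\<nu>\<in>F. of_int (schur_coeff \<nu> f) * schur \<nu>)" by blast
  then show thesis by (intro that[of F]) auto
qed

lemma symfun_eqI_schur_coeff:
  assumes "\<And>\<nu>. \<nu> \<in> partitions \<Longrightarrow> schur_coeff \<nu> f = schur_coeff \<nu> g"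
  shows "f = g"
proof -
  obtain F where F: "finite F" "F \<subseteq> partitions"
    "{\<nu> \<in> partitions. schur_coeff \<nu> (f - g) \<noteq> 0} \<subseteq> F"
    "f - g = (\<Sum>\<nu>\<in>F. of_int (schur_coeff \<nu> (f - g)) * schur \<nu>)"
    by (rule schur_expansion[of "f - g"])
  have "(\<Sum>\<nu>\<in>F. of_int (schur_coeff \<nu> (f - g)) * schur \<nu>) = 0"
    using assms F(2) by (intro sum.neutral) (auto simp: schur_coeff.diff)
  with F(4) have "f - g = 0" by (rule trans)
  then show ?thesis by simp
qed

section \<open>The scalar product and skew Schur functions\<close>

text \<open>Settles uniqueness in the description of the scalar product, by an induction over Schur
  functions in each argument.\<close>

lemma biadditive_eqI:
  assumes "\<And>f. additive (B f)" "\<And>g. additive (\<lambda>f. B f g)"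
    and "\<And>f. additive (B' f)" "\<And>g. additive (\<lambda>f. B' f g)"
    and "\<And>lam \<mu>. lam \<in> partitions \<Longrightarrow> \<mu> \<in> partitions \<Longrightarrow> B (schur lam) (schur \<mu>) = B' (schur lam) (schur \<mu>)"
  shows "B f g = (B' f g :: int)"
proof -
  have "B (schur lam) g = B' (schur lam) g" if lam: "lam \<in> partitions" for lam
    by (induction g rule: schur_induct)
      (simp_all add: assms(1,3) assms(5)[OF lam] additive.zero additive.add additive.diff)
  then show ?thesis
    by (induction f rule: schur_induct)
      (simp_all add: additive.zero[OF assms(2)] additive.zero[OF assms(4)]
         additive.add[OF assms(2)] additive.add[OF assms(4)] additive.diff[OF assms(2)] additive.diff[OF assms(4)])
qed

lemma finite_schur_coeff: "finite {\<nu> \<in> partitions. schur_coeff \<nu> f \<noteq> 0}"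
proof -
  obtain F where F: "finite F" "F \<subseteq> partitions"
    "{\<nu> \<in> partitions. schur_coeff \<nu> f \<noteq> 0} \<subseteq> F"
    "f = (\<Sum>\<nu>\<in>F. of_int (schur_coeff \<nu> f) * schur \<nu>)"
    by (rule schur_expansion[of f])
  show ?thesis using F(3,1) by (rule finite_subset)
qed

text \<open>The witness for the scalar product. \<open>finite_schur_coeff\<close> guarantees finite
  support; on infinite support \<open>Sum_any\<close> would give 0.\<close>

definition schur_form :: "symfun \<Rightarrow> symfun \<Rightarrow> int" where
  "schur_form f g = Sum_any (\<lambda>\<nu>. of_bool (\<nu> \<in> partitions) * (schur_coeff \<nu> f * schur_coeff \<nu> g))"

lemma schur_form_commute: "schur_form f g = schur_form g f"
  by (simp add: schur_form_def mult.commute)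

lemma additive_schur_form: "additive (schur_form f)"
proof
  fix g h
  have fin: "finite {\<nu>. of_bool (\<nu> \<in> partitions) * (schur_coeff \<nu> f * schur_coeff \<nu> g) \<noteq> 0}" for g
    by (rule finite_subset[OF _ finite_schur_coeff[of f]]) auto
  show "schur_form f (g + h) = schur_form f g + schur_form f h"
    unfolding schur_form_def
    by (subst Sum_any.distrib[OF fin fin, symmetric]) (simp add: schur_coeff.add algebra_simps)
qed

lemma schur_form_schur:
  assumes "\<nu> \<in> partitions"
  shows "schur_form (schur \<nu>) g = schur_coeff \<nu> g"
proof -
  have eq: "(\<lambda>\<mu>. of_bool (\<mu> \<in> partitions) * (schur_coeff \<mu> (schur \<nu>) * schur_coeff \<mu> g)) =
      (\<lambda>\<mu>. schur_coeff \<mu> g when \<mu> = \<nu>)"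
    using assms by (auto simp: schur_coeff_schur when_def)
  show ?thesis unfolding schur_form_def eq by simp
qed

lemma scalar_prod_eq: "scalar_prod = schur_form"
  unfolding scalar_prod_def
proof (rule the_equality)
  have add': "additive (\<lambda>f. schur_form f g)" for g
    using additive_schur_form[of g] by (simp add: schur_form_commute[of _ g])
  show *: "(\<forall>f. additive (schur_form f)) \<and> (\<forall>g. additive (\<lambda>f. schur_form f g)) \<and>
      (\<forall>lam\<in>partitions. \<forall>\<mu>\<in>partitions. schur_form (schur lam) (schur \<mu>) = of_bool (lam = \<mu>))"
    using additive_schur_form add' by (auto simp: schur_form_schur schur_coeff_schur)
  fix B :: "symfun \<Rightarrow> symfun \<Rightarrow> int"
  assume B: "(\<forall>f. additive (B f)) \<and> (\<forall>g. additive (\<lambda>f. B f g)) \<and>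
      (\<forall>lam\<in>partitions. \<forall>\<mu>\<in>partitions. B (schur lam) (schur \<mu>) = of_bool (lam = \<mu>))"
  show "B = schur_form"
  proof (intro ext)
    show "B f g = schur_form f g" for f g
      by (rule biadditive_eqI) (use B * in \<open>simp_all\<close>)
  qed
qed

lemma scalar_prod_schur_left: "\<nu> \<in> partitions \<Longrightarrow> scalar_prod (schur \<nu>) g = schur_coeff \<nu> g"
  by (simp add: scalar_prod_eq schur_form_schur)

lemma scalar_prod_schur_right: "\<nu> \<in> partitions \<Longrightarrow> scalar_prod f (schur \<nu>) = schur_coeff \<nu> f"
  by (simp add: scalar_prod_eq schur_form_schur schur_form_commute[of f])

lemma skew_schur_characterisation:
  assumes lam: "lam \<in> partitions" and \<kappa>: "\<kappa> \<in> partitions"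
  shows "scalar_prod (tableau_series lam \<kappa>) f = scalar_prod (schur lam) (schur \<kappa> * f)"
proof (induction f rule: schur_induct)
  case zero
  then show ?case
    by (simp add: scalar_prod_eq additive.zero[OF additive_schur_form])
next
  \<comment> \<open>As \<open>schur 0\<close> is 1, the product formula with \<mu> = 0 yields the
    coefficients of the tableau series itself.\<close>
  have "schur_coeff \<nu> (tableau_series lam \<kappa>) = schur_coeff lam (schur \<kappa> * schur \<nu>)"
    if "\<nu> \<in> partitions" for \<nu>
    using schur_coeff_schur_mult_tableau_series[OF that zero_in_partitions, of lam \<kappa>]
      schur_coeff_schur_mult_tableau_series[OF lam \<kappa>, of \<nu> 0] card_tableau_pairs_commute[of lam \<kappa> \<nu> 0]
    by (simp add: schur_0 schur_eq[OF that])
  then have *: "scalar_prod (tableau_series lam \<kappa>) (schur \<nu>) = scalar_prod (schur lam) (schur \<kappa> * schur \<nu>)"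
    if "\<nu> \<in> partitions" for \<nu>
    using that by (simp add: scalar_prod_schur_right scalar_prod_schur_left lam)
  {
    case (add f \<nu>)
    then show ?case
      using *[of \<nu>] by (simp add: scalar_prod_eq additive.add[OF additive_schur_form] distrib_left)
  next
    case (diff f \<nu>)
    then show ?case
      using *[of \<nu>] by (simp add: scalar_prod_eq additive.diff[OF additive_schur_form] right_diff_distrib)
  }
qed

lemma skew_schur_eq:
  assumes "lam \<in> partitions" "\<kappa> \<in> partitions"
  shows "skew_schur lam \<kappa> = tableau_series lam \<kappa>"
  unfolding skew_schur_def
proof (rule the_equality)
  fix h assume h: "\<forall>f. scalar_prod h f = scalar_prod (schur lam) (schur \<kappa> * f)"
  show "h = tableau_series lam \<kappa>"
  proof (rule symfun_eqI_schur_coeff)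
    fix \<nu> assume "\<nu> \<in> partitions"
    then show "schur_coeff \<nu> h = schur_coeff \<nu> (tableau_series lam \<kappa>)"
      using h skew_schur_characterisation[OF assms, of "schur \<nu>"]
      by (simp flip: scalar_prod_schur_right)
  qed
qed (simp add: skew_schur_characterisation[OF assms])

lemma scalar_prod_skew_schur:
  assumes "\<kappa> \<in> partitions" and "lam \<in> partitions" and "\<mu> \<in> partitions" and "\<nu> \<in> partitions"
  shows "scalar_prod (skew_schur lam \<kappa>) (skew_schur \<nu> \<mu>) = int (card (tableau_pairs lam \<kappa> \<nu> \<mu>))"
proof -
  have "scalar_prod (skew_schur lam \<kappa>) (skew_schur \<nu> \<mu>) =
      scalar_prod (tableau_series \<nu> \<mu>) (tableau_series lam \<kappa>)"
    by (simp add: skew_schur_eq assms scalar_prod_eq schur_form_commute[of "tableau_series lam \<kappa>"])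
  also have "\<dots> = schur_coeff \<nu> (schur \<mu> * tableau_series lam \<kappa>)"
    by (simp add: skew_schur_characterisation assms scalar_prod_schur_left)
  finally show ?thesis
    by (simp add: schur_coeff_schur_mult_tableau_series assms)
qed

section \<open>The two sums over matrices\<close>

lemma zcomp_eq_diff_iff: "zcomp \<alpha> = zcomp \<beta> - zcomp \<gamma> \<longleftrightarrow> \<gamma> + \<alpha> = \<beta>"
proof -
  have "int a = int b - int c \<longleftrightarrow> c + a = b" for a b c by linarith
  then show ?thesis
    by (simp add: poly_mapping_eq_iff fun_eq_iff lookup_add lookup_minus)
qed

text \<open>The prescribed margins are the end conditions of the two tableaux, stated with integer
  differences.\<close>

lemma tableau_pairs_eq:
  "tableau_pairs lam \<kappa> \<nu> \<mu> = {M \<in> matrices (zcomp lam - zcomp \<kappa>) (zcomp \<nu> - zcomp \<mu>).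
     (\<forall>l. \<kappa> + (\<Sum>j<l. mat_col M j) \<leftharpoondown> \<kappa> + (\<Sum>j\<le>l. mat_col M j)) \<and>
     (\<forall>k. \<mu> + (\<Sum>i<k. mat_row M i) \<leftharpoondown> \<mu> + (\<Sum>i\<le>k. mat_row M i))}"
  by (auto simp: tableau_pairs_def matrices_def Tabl_iff zcomp_eq_diff_iff partial_shape_def
      lessThan_Suc_atMost simp del: sum.lessThan_Suc)

theorem theorem5p2:
  fixes \<kappa> lam \<mu> \<nu> :: composition
  assumes "\<kappa> \<in> partitions" and "lam \<in> partitions" and "\<mu> \<in> partitions" and "\<nu> \<in> partitions"
  shows
    "scalar_prod (skew_schur lam \<kappa>) (skew_schur \<nu> \<mu>) =
       (\<Sum>M\<in>matrices (zcomp lam - zcomp \<kappa>) (zcomp \<nu> - zcomp \<mu>).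
          of_bool (\<forall>l. \<kappa> + (\<Sum>j<l. mat_col M j) \<leftharpoondown> \<kappa> + (\<Sum>j\<le>l. mat_col M j)) *
          of_bool (\<forall>k. \<mu> + (\<Sum>i<k. mat_row M i) \<leftharpoondown> \<mu> + (\<Sum>i\<le>k. mat_row M i)))
     \<and> scalar_prod (skew_schur lam \<kappa>) (skew_schur \<nu> \<mu>) =
       Sum_any (\<lambda>M. of_bool (M \<in> Tabl lam \<kappa>) * of_bool (mat_transpose M \<in> Tabl \<nu> \<mu>))"
proof
  note eq = scalar_prod_skew_schur[OF assms]
  show "scalar_prod (skew_schur lam \<kappa>) (skew_schur \<nu> \<mu>) =
       (\<Sum>M\<in>matrices (zcomp lam - zcomp \<kappa>) (zcomp \<nu> - zcomp \<mu>).
          of_bool (\<forall>l. \<kappa> + (\<Sum>j<l. mat_col M j) \<leftharpoondown> \<kappa> + (\<Sum>j\<le>l. mat_col M j)) *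
          of_bool (\<forall>k. \<mu> + (\<Sum>i<k. mat_row M i) \<leftharpoondown> \<mu> + (\<Sum>i\<le>k. mat_row M i)))"
    unfolding eq tableau_pairs_eq of_bool_conj[symmetric]
    by (simp add: sum_of_bool_eq finite_matrices Int_def)
  \<comment> \<open>Finiteness of the set of pairs turns \<open>Sum_any\<close> into an ordinary sum
    over it.\<close>
  have "Sum_any (\<lambda>M. of_bool (M \<in> Tabl lam \<kappa>) * of_bool (mat_transpose M \<in> Tabl \<nu> \<mu>)) =
      (\<Sum>M\<in>tableau_pairs lam \<kappa> \<nu> \<mu>. of_bool (M \<in> Tabl lam \<kappa>) * of_bool (mat_transpose M \<in> Tabl \<nu> \<mu>) :: int)"
    by (rule Sum_any.expand_superset) (auto simp: tableau_pairs_def finite_Tabl_pairs)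
  also have "\<dots> = int (card (tableau_pairs lam \<kappa> \<nu> \<mu>))"
    by (simp add: tableau_pairs_def)
  finally show "scalar_prod (skew_schur lam \<kappa>) (skew_schur \<nu> \<mu>) =
      Sum_any (\<lambda>M. of_bool (M \<in> Tabl lam \<kappa>) * of_bool (mat_transpose M \<in> Tabl \<nu> \<mu>))"
    by (simp add: eq)
qed

end
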